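(* Let $\Lambda=\{\lambda_n,\mu_n\}_{n=1}^{\infty}$ belong to the class $ABC$ and let $-\infty<\gamma<\beta<\infty$. For $n\in\mathbb{N}$ and $k=0,\dots,\mu_n-1$ let $e_{n,k}(x)=x^ke^{\lambda_nx}$, $E_{\Lambda_{n,k}}=E_\Lambda\setminus\{e_{n,k}\}$, and \[ D_{\gamma,\beta,n,k}=\inf_{g\in\overline{\mathrm{span}}(E_{\Lambda_{n,k}})}\|e_{n,k}-g\|_{C[\gamma,\beta]}, \] the closed span being taken in $C[\gamma,\beta]$ with the supremum norm. Then for every $\epsilon>0$ there is $u_\epsilon>0$, independent of $n$ and $k$ (depending on $\Lambda$ and $\beta-\gamma$), such that $D_{\gamma,\beta,n,k}\ge u_\epsilon e^{(\beta-\epsilon)\Re\lambda_n}$ for all $n\in\mathbb{N}$, $k=0,\dots,\mu_n-1$.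
   Context: A multiplicity sequence $\Lambda=\{\lambda_n,\mu_n\}_{n=1}^\infty$ consists of distinct nonzero complex numbers $\lambda_n$ with $|\lambda_n|\to\infty$, $|\lambda_n|\le|\lambda_{n+1}|$, and positive integers $\mu_n$. $A^0_{|z|}$ is the space of entire functions $F$ with: for every $\epsilon>0$ there is $M_\epsilon$ with $|F(z)|\le M_\epsilon e^{\epsilon|z|}$ on $\mathbb{C}$. $\Lambda$ is an interpolating variety for $A^0_{|z|}$ if for every doubly indexed complex sequence $(a_{n,k})_{n\in\mathbb{N},0\le k\le\mu_n-1}$ with $\sup_n\sum_{k}|a_{n,k}|e^{-\epsilon|\lambda_n|}<\infty$ for every $\epsilon>0$ there is $f\in A^0_{|z|}$ with $f^{(k)}(\lambda_n)/k!=a_{n,k}$ for all $n,k$. $\Lambda\in ABC$ means: (A) $\sum_n\mu_n/|\lambda_n|<\infty$; (B) $\sup_n|\arg\lambda_n|<\pi/2$; (C) $\Lambda$ is an interpolating variety for $A^0_{|z|}$. $E_\Lambda=\{x^ke^{\lambda_n x}:n\in\mathbb{N},\ 0\le k\le\mu_n-1\}$; $C[\gamma,\beta]$ is the space of complex continuous functions on $[\gamma,\beta]$.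
   Formalization: The constant u_ε is independent of n and k but may depend on Λ, γ and β, not only on Λ and β−γ; dependence on β−γ alone fails whenever some μ_n ≥ 2 (approximate e^{λ_n x} by x e^{λ_n x}/t on [t,t+1], t→∞). *)

theory Defs
  imports "HOL-Complex_Analysis.Complex_Analysis"
begin

text \<open>Multiplicity sequence (indexed from 0 instead of 1): distinct nonzero points,
  moduli nondecreasing and tending to infinity, positive multiplicities.\<close>
definition multiplicity_seq :: "(nat \<Rightarrow> complex) \<Rightarrow> (nat \<Rightarrow> nat) \<Rightarrow> bool" where
  "multiplicity_seq lam mu \<longleftrightarrow>
     inj lam \<and> (\<forall>n. lam n \<noteq> 0) \<and> (\<forall>n. norm (lam n) \<le> norm (lam (Suc n))) \<and>
     filterlim (\<lambda>n. norm (lam n)) at_top sequentially \<and> (\<forall>n. mu n \<ge> 1)"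

definition A0 :: "(complex \<Rightarrow> complex) set" where
  "A0 = {F. F holomorphic_on UNIV \<and>
             (\<forall>\<epsilon>>0. \<exists>M. \<forall>z. norm (F z) \<le> M * exp (\<epsilon> * norm z))}"

definition interpolating_variety_A0 :: "(nat \<Rightarrow> complex) \<Rightarrow> (nat \<Rightarrow> nat) \<Rightarrow> bool" where
  "interpolating_variety_A0 lam mu \<longleftrightarrow>
     (\<forall>a :: nat \<Rightarrow> nat \<Rightarrow> complex.
        (\<forall>\<epsilon>>0. bdd_above (range (\<lambda>n. (\<Sum>k<mu n. norm (a n k)) * exp (- \<epsilon> * norm (lam n)))))
        \<longrightarrow> (\<exists>f\<in>A0. \<forall>n. \<forall>k<mu n. (deriv ^^ k) f (lam n) / of_nat (fact k) = a n k))"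

definition class_ABC :: "(nat \<Rightarrow> complex) \<Rightarrow> (nat \<Rightarrow> nat) \<Rightarrow> bool" where
  "class_ABC lam mu \<longleftrightarrow>
     multiplicity_seq lam mu \<and>
     summable (\<lambda>n. real (mu n) / norm (lam n)) \<and>
     (\<exists>\<theta> < pi / 2. \<forall>n. \<bar>Arg (lam n)\<bar> \<le> \<theta>) \<and>
     interpolating_variety_A0 lam mu"

definition emon :: "(nat \<Rightarrow> complex) \<Rightarrow> nat \<Rightarrow> nat \<Rightarrow> real \<Rightarrow> complex" where
  "emon lam n k x = (complex_of_real x) ^ k * exp (lam n * complex_of_real x)"

definition supnorm_on :: "real \<Rightarrow> real \<Rightarrow> (real \<Rightarrow> complex) \<Rightarrow> real" where
  "supnorm_on \<gamma> \<beta> f = (SUP x\<in>{\<gamma>..\<beta>}. norm (f x))"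

definition span_E_minus :: "(nat \<Rightarrow> complex) \<Rightarrow> (nat \<Rightarrow> nat) \<Rightarrow> nat \<Rightarrow> nat \<Rightarrow> (real \<Rightarrow> complex) set" where
  "span_E_minus lam mu n k =
     {g. \<exists>S c. finite S \<and> S \<subseteq> {(m, j). j < mu m} - {(n, k)} \<and>
               g = (\<lambda>x. \<Sum>(m, j)\<in>S. c (m, j) * emon lam m j x)}"

definition closed_span_E_minus :: "real \<Rightarrow> real \<Rightarrow> (nat \<Rightarrow> complex) \<Rightarrow> (nat \<Rightarrow> nat) \<Rightarrow> nat \<Rightarrow> nat \<Rightarrow> (real \<Rightarrow> complex) set" where
  "closed_span_E_minus \<gamma> \<beta> lam mu n k =
     {f. continuous_on {\<gamma>..\<beta>} f \<and>
         (\<forall>\<delta>>0. \<exists>p\<in>span_E_minus lam mu n k. supnorm_on \<gamma> \<beta> (\<lambda>x. f x - p x) < \<delta>)}"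

definition D_dist :: "real \<Rightarrow> real \<Rightarrow> (nat \<Rightarrow> complex) \<Rightarrow> (nat \<Rightarrow> nat) \<Rightarrow> nat \<Rightarrow> nat \<Rightarrow> real" where
  "D_dist \<gamma> \<beta> lam mu n k =
     (INF g\<in>closed_span_E_minus \<gamma> \<beta> lam mu n k. supnorm_on \<gamma> \<beta> (\<lambda>x. emon lam n k x - g x))"

end

theory Submission
  imports Defs
begin

text \<open>
  By duality it suffices to exhibit, for each $(n,k)$, an entire function $G$ with
  $G^{(j)}(\lambda_m) = k!$ if $(m,j) = (n,k)$ and $0$ otherwise, which is the transform of a
  functional on $C[\gamma,\beta]$ of norm $O(e^{-(\beta-\epsilon) \Re \lambda_n})$. Only finitely many
  $\lambda_m$ occur in an element of the span, so finite products suffice as long as the bounds do not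
  depend on their length $N$.

  Baire's theorem applied to bounded data makes the interpolation in $A^0_{|z|}$ uniform: one $M$ serves
  for all functions $f$ with unit jets. Write $f = Q g$ with
  $Q = \prod_{m<N, m \ne n} (1 - z/\lambda_m)^{\mu_m}$; reflecting zeros in a circle bounds $g$ near
  $\lambda_n$. Replace $g$ by $e^{bz} K P \tau$, where $P = \prod_{m<N} (1 + z/\lambda_m)^{\mu_m}$
  makes $P Q$ even up to the factor of $\lambda_n$, so that it grows on the imaginary axis no faster
  than $\prod (1 + y^2/|\lambda_m|^2)^{\mu_m}$; $K$ is a product of functions
  $(\sinh (c z)/(c z))^2$ of small total type which absorbs this growth; and $\tau$ is the Taylor
  polynomial of $g / (e^{bz} K P)$ at $\lambda_n$, which restores the jet of $f$ there. The inverse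
  Laplace transform of $G$ along the imaginary axis is then the required density on $[\gamma,\beta]$.
\<close>

section \<open>Functionals from entire functions of exponential type\<close>

text \<open>The obstacle is uniformity in \<open>N\<close>: every bound that reaches the final
  constant must survive an unbounded number of factors. For non-real lambda_m the factor 1 -
  iy/lambda_m may exceed 1 in modulus to first order in y, whereas a \<open>sinhc\<close> factor on
  the axis is 1 - O(y^2), so it cannot compensate with constant 1. Multiplying by P removes the
  linear term, and 1 + y^2/|lambda_m|^2 can be compensated with constant 1. The price is that K and
  P must not be small near lambda_n. The sector condition (B) ensures this: the zeros of P then lie
  in the left half-plane, and those of K on the imaginary axis. The losses near lambda_n are exp(eta
  |lambda_n|) with eta as small as desired, because (A) makes the sum of mu_m min(1, R/|lambda_m|)
  equal to o(R) uniformly in \<open>N\<close>; by (B) again they fit into exp(epsilon Re lambda_n).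
  The polynomial tau has degree below mu_n, so its growth takes the place of the factor that Q lacks
  at lambda_n. The growth bounds of G off the axis may depend on \<open>N\<close>: they only justify
  the inversion.\<close>

lemma Cauchy_left_half_circle:
  fixes F :: "complex \<Rightarrow> complex"
  assumes hol: "F holomorphic_on {z. Re z < r}" and r: "r > 0" and Y: "Y > 0"
  shows "contour_integral (linepath (- (\<i> * of_real Y)) (\<i> * of_real Y)) F =
         - contour_integral (part_circlepath 0 Y (pi/2) (3/2*pi)) F"
proof -
  let ?l = "linepath (- (\<i> * of_real Y)) (\<i> * of_real Y)"
  let ?c = "part_circlepath 0 Y (pi/2) (3/2*pi)"
  have e1: "exp (\<i> * complex_of_real (pi/2)) = \<i>"
    by (simp add: exp_Euler cos_of_real sin_of_real complex_eq_iff flip: of_real_divide)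
  have c3: "cos (3 * pi / 2) = 0" "sin (3 * pi / 2) = -1"
    using cos_3over2_pi sin_3over2_pi by simp_all
  have e2: "exp (\<i> * complex_of_real (3/2*pi)) = -\<i>"
    unfolding cis_conv_exp[symmetric] by (simp add: complex_eq_iff c3)
  have pl: "path_image ?l \<subseteq> {z. Re z < r}"
  proof -
    have "closed_segment (- (\<i> * of_real Y)) (\<i> * of_real Y) \<subseteq> {z. Re z < r}"
      using r by (intro closed_segment_subset convex_halfspace_Re_lt) auto
    then show ?thesis by simp
  qed
  have pc: "path_image ?c \<subseteq> {z. Re z < r}"
  proof
    fix z assume "z \<in> path_image ?c"
    then obtain t where t: "pi/2 \<le> t" "t \<le> 3/2*pi" and z: "z = 0 + of_real Y * cis t"
      by (auto simp: path_image_part_circlepath' rcis_def closed_segment_eq_real_ivl image_iff)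
    have "cos t = - cos (t - pi)" by simp
    moreover have "cos (t - pi) \<ge> 0" using t by (intro cos_ge_zero) auto
    ultimately have "Y * cos t \<le> 0" using Y by (simp add: mult_le_0_iff)
    then show "z \<in> {z. Re z < r}" using r z by simp
  qed
  have j: "pathfinish ?l = pathstart ?c" using e1 by simp
  have "(F has_contour_integral 0) (?l +++ ?c)"
  proof (rule Cauchy_theorem_convex_simple[OF hol convex_halfspace_Re_lt])
    show "valid_path (?l +++ ?c)" using j by (intro valid_path_join) auto
    show "path_image (?l +++ ?c) \<subseteq> {z. Re z < r}" using pl pc j by (simp add: path_image_join)
    show "pathfinish (?l +++ ?c) = pathstart (?l +++ ?c)" using e2 by simp
  qed
  moreover have "F contour_integrable_on ?l"
    by (intro contour_integrable_holomorphic_simple[OF hol open_halfspace_Re_lt] pl) auto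
  moreover have "F contour_integrable_on ?c"
    by (intro contour_integrable_holomorphic_simple[OF hol open_halfspace_Re_lt] pc) auto
  ultimately have "contour_integral ?l F + contour_integral ?c F = 0"
    using j by (metis contour_integral_join contour_integral_unique valid_path_linepath valid_path_part_circlepath)
  then show ?thesis by (simp add: eq_neg_iff_add_eq_0)
qed

lemma contour_integral_part_circlepath_split:
  assumes "F contour_integrable_on part_circlepath c r a b" "a < m" "m < b"
  shows "contour_integral (part_circlepath c r a b) F =
    contour_integral (part_circlepath c r a m) F + contour_integral (part_circlepath c r m b) F"
  using assms
  by (simp add: contour_integral_part_circlepath_eq contour_integrable_part_circlepath_iff
      Henstock_Kurzweil_Integration.integral_combine)

section \<open>Laplace transforms of continuous densities on a compact interval, and their
  inversion\<close>

lemma laplace_higher_deriv: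
  fixes q :: "real \<Rightarrow> complex"
  assumes cont: "continuous_on {a..b} q"
  shows "(deriv ^^ j) (\<lambda>l. integral {a..b} (\<lambda>x. q x * exp (l * of_real x))) l =
     integral {a..b} (\<lambda>x. q x * of_real x ^ j * exp (l * of_real x))"
proof -
  have D: "((\<lambda>l. integral (cbox a b) (\<lambda>x. q x * of_real x ^ j * exp (l * of_real x))) has_field_derivative
      integral (cbox a b) (\<lambda>x. q x * of_real x ^ Suc j * exp (l * of_real x))) (at l within UNIV)" for j l
  proof (rule leibniz_rule_field_derivative)
    show "((\<lambda>l. q t * of_real t ^ j * exp (l * of_real t)) has_field_derivative
        q t * of_real t ^ Suc j * exp (l * of_real t)) (at l within UNIV)" for l t
      by (auto intro!: derivative_eq_intros)
    show "(\<lambda>x. q x * of_real x ^ j * exp (l * of_real x)) integrable_on cbox a b" for l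
      using cont by (intro integrable_continuous continuous_intros) auto
    have "continuous_on (UNIV \<times> {a..b}) (\<lambda>x. q (snd x))"
      by (rule continuous_on_compose2[OF cont]) (auto intro: continuous_intros)
    then show "continuous_on (UNIV \<times> cbox a b) (\<lambda>(l, x). q x * of_real x ^ Suc j * exp (l * of_real x))"
      unfolding split_def by (intro continuous_intros) (auto)
  qed auto
  show ?thesis
  proof (induction j arbitrary: l)
    case 0
    then show ?case by simp
  next
    case (Suc j)
    have "(deriv ^^ j) (\<lambda>l. integral {a..b} (\<lambda>x. q x * exp (l * of_real x))) =
      (\<lambda>l. integral {a..b} (\<lambda>x. q x * of_real x ^ j * exp (l * of_real x)))"
      using Suc by blast
    then show ?case using DERIV_imp_deriv[OF D[of j l]] by simp
  qed
qed

lemma laplace_holomorphic: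
  fixes q :: "real \<Rightarrow> complex"
  assumes cont: "continuous_on {a..b} q"
  shows "(\<lambda>l. integral {a..b} (\<lambda>x. q x * exp (l * of_real x))) holomorphic_on UNIV"
proof -
  have "((\<lambda>l. integral (cbox a b) (\<lambda>x. q x * exp (l * of_real x))) has_field_derivative
      integral (cbox a b) (\<lambda>x. q x * of_real x * exp (l * of_real x))) (at l within UNIV)" for l
  proof (rule leibniz_rule_field_derivative)
    show "((\<lambda>l. q t * exp (l * of_real t)) has_field_derivative
        q t * of_real t * exp (l * of_real t)) (at l within UNIV)" for l t
      by (auto intro!: derivative_eq_intros)
    show "(\<lambda>x. q x * exp (l * of_real x)) integrable_on cbox a b" for l
      using cont by (intro integrable_continuous continuous_intros) auto
    have "continuous_on (UNIV \<times> {a..b}) (\<lambda>x. q (snd x))"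
      by (rule continuous_on_compose2[OF cont]) (auto intro: continuous_intros)
    then show "continuous_on (UNIV \<times> cbox a b) (\<lambda>(l, x). q x * of_real x * exp (l * of_real x))"
      unfolding split_def by (intro continuous_intros) auto
  qed auto
  then show ?thesis unfolding holomorphic_on_def field_differentiable_def by auto
qed

text \<open>The Fourier inversion integral along the imaginary axis, cut off at height
  \<open>Y\<close>. The density itself is never passed to the limit; only its transforms
  are.\<close>

definition inv_trunc :: "(complex \<Rightarrow> complex) \<Rightarrow> real \<Rightarrow> real \<Rightarrow> complex" where
  "inv_trunc G Y x = integral {-Y..Y} (\<lambda>y. G (\<i> * of_real y) * exp (- (\<i> * of_real y * of_real x))) / (2 * of_real pi)"

lemma continuous_inv_trunc:
  assumes "continuous_on UNIV G"
  shows "continuous_on S (inv_trunc G Y)"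
proof -
  have 1: "continuous_on UNIV (\<lambda>x. integral (cbox (-Y) Y)
     (\<lambda>y. G (\<i> * of_real y) * exp (- (\<i> * of_real y * complex_of_real x))))"
  proof (rule integral_continuous_on_param)
    have "continuous_on (UNIV \<times> cbox (-Y) Y) (\<lambda>x::real\<times>real. G (\<i> * of_real (snd x)))"
      by (rule continuous_on_compose2[OF assms]) (auto intro!: continuous_intros)
    then show "continuous_on (UNIV \<times> cbox (-Y) Y)
     (\<lambda>(x, y). G (\<i> * of_real y) * exp (- (\<i> * of_real y * complex_of_real x)))"
      unfolding split_def by (intro continuous_intros) auto
  qed
  have "continuous_on UNIV (inv_trunc G Y)"
    unfolding inv_trunc_def[abs_def] using 1 by (intro continuous_intros) auto
  then show ?thesis using continuous_on_subset by blast
qed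

text \<open>The integral of 1/(1 + y^2) is at most pi, whatever the cut-off, and the normalisation
  1/(2 pi) leaves \<open>C / 2\<close>.\<close>

lemma norm_inv_trunc_le:
  assumes cont: "continuous_on UNIV G" and C: "C \<ge> 0"
    and bd: "\<And>y::real. norm (G (\<i> * of_real y)) \<le> C / (1 + y\<^sup>2)"
  shows "norm (inv_trunc G Y x) \<le> C / 2"
proof (cases "Y \<ge> 0")
  case True
  have hi: "((\<lambda>y. C * (1 / (1 + y\<^sup>2))) has_integral C * (arctan Y - arctan (-Y))) {-Y..Y}"
  proof (intro has_integral_mult_right fundamental_theorem_of_calculus)
    show "(arctan has_vector_derivative 1 / (1 + y\<^sup>2)) (at y within {-Y..Y})" for y
      using DERIV_arctan[of y] has_field_derivative_at_within
      by (auto simp: has_real_derivative_iff_has_vector_derivative[symmetric] inverse_eq_divide)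
  qed (use True in auto)
  have c: "continuous_on {-Y..Y} (\<lambda>y. G (\<i> * of_real y))"
    by (rule continuous_on_compose2[OF cont]) (auto intro!: continuous_intros)
  have "norm (integral {-Y..Y} (\<lambda>y. G (\<i> * of_real y) * exp (- (\<i> * of_real y * of_real x))))
      \<le> integral {-Y..Y} (\<lambda>y. C * (1 / (1 + y\<^sup>2)))"
  proof (rule integral_norm_bound_integral)
    show "(\<lambda>y. G (\<i> * of_real y) * exp (- (\<i> * of_real y * of_real x))) integrable_on {-Y..Y}"
      using c by (intro integrable_continuous_real continuous_intros)
    show "norm (G (\<i> * of_real y) * exp (- (\<i> * of_real y * of_real x))) \<le> C * (1 / (1 + y\<^sup>2))" for y
      using bd[of y] by (simp add: norm_mult)
  qed (use hi in auto)
  also have "\<dots> = C * (arctan Y - arctan (-Y))" using hi by (rule integral_unique)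
  also have "\<dots> \<le> C * pi"
    using arctan_ubound[of Y] C by (intro mult_left_mono) (auto simp: arctan_minus)
  finally show ?thesis by (simp add: inv_trunc_def norm_divide field_simps)
qed (use C in \<open>simp add: inv_trunc_def\<close>)

text \<open>Cauchy's formula on the full circle, with only the left half-circle deformed to the
  imaginary axis, evaluates the truncated inversion integral.\<close>

lemma laplace_inv_trunc_error:
  fixes G :: "complex \<Rightarrow> complex"
  assumes hol: "G holomorphic_on UNIV" and gb: "\<gamma> \<le> \<beta>" and C: "C \<ge> 0"
    and right: "\<And>z. Re z \<ge> 0 \<Longrightarrow> norm (G z) \<le> C * exp (\<beta> * Re z) / (1 + (norm z)\<^sup>2)"
    and left: "\<And>z. Re z \<le> 0 \<Longrightarrow> norm (G z) \<le> C * exp (\<gamma> * Re z) / (1 + (norm z)\<^sup>2)"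
    and l: "Re l > 0" "norm l < Y"
  shows "norm (integral {\<gamma>..\<beta>} (\<lambda>x. inv_trunc G Y x * exp (l * of_real x)) - G l)
     \<le> C * (exp (\<beta> * Re l) + exp (\<gamma> * Re l)) / (Y - norm l)"
proof -
  have Y: "Y > 0" using l norm_ge_zero[of l] by linarith
  \<comment> \<open>Integrating exp((l - iy)x) over x leaves two endpoint terms divided by l - iy.
    \<open>E c\<close> is the endpoint term at \<open>c\<close> with denominator z - l, so after
    Fubini the integrand is \<open>E \<gamma>\<close> minus \<open>E \<beta>\<close>.\<close>
  define E where "E c z = G z * exp ((l - z) * of_real c) / (z - l)" for c :: real and z
  have cG: "continuous_on S G" for S
    using hol holomorphic_on_imp_continuous_on continuous_on_subset by blast
  have lny: "l - \<i> * of_real y \<noteq> 0" for y using l by (auto simp: complex_eq_iff)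
  have expint: "integral {\<gamma>..\<beta>} (\<lambda>x. exp ((l - \<i> * of_real y) * of_real x)) =
      (exp ((l - \<i> * of_real y) * of_real \<beta>) - exp ((l - \<i> * of_real y) * of_real \<gamma>)) / (l - \<i> * of_real y)" for y
  proof -
    let ?w = "l - \<i> * of_real y"
    have "((\<lambda>x. exp (?w * of_real x)) has_integral
        (exp (?w * of_real \<beta>) / ?w - exp (?w * of_real \<gamma>) / ?w)) {\<gamma>..\<beta>}"
    proof (rule fundamental_theorem_of_calculus[OF gb])
      fix x
      have "((\<lambda>x. exp (?w * x) / ?w) has_field_derivative exp (?w * of_real x)) (at (of_real x))"
        using lny by (auto intro!: derivative_eq_intros)
      then show "((\<lambda>x. exp (?w * of_real x) / ?w) has_vector_derivative exp (?w * of_real x)) (at x within {\<gamma>..\<beta>})"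
        by (rule has_vector_derivative_real_field[THEN has_vector_derivative_at_within])
    qed
    then show ?thesis by (simp add: integral_unique diff_divide_distrib)
  qed
  have "integral {\<gamma>..\<beta>} (\<lambda>x. inv_trunc G Y x * exp (l * of_real x)) =
     integral {\<gamma>..\<beta>} (\<lambda>x. integral {-Y..Y} (\<lambda>y. G (\<i> * of_real y) * exp ((l - \<i> * of_real y) * of_real x))) / (2 * of_real pi)"
  proof -
    have "inv_trunc G Y x * exp (l * of_real x) =
      integral {-Y..Y} (\<lambda>y. G (\<i> * of_real y) * exp ((l - \<i> * of_real y) * of_real x)) / (2 * of_real pi)" for x
    proof -
      have "integral {-Y..Y} (\<lambda>y. G (\<i> * of_real y) * exp ((l - \<i> * of_real y) * of_real x)) =
        integral {-Y..Y} (\<lambda>y. G (\<i> * of_real y) * exp (- (\<i> * of_real y * of_real x)) * exp (l * of_real x))"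
        by (intro integral_cong) (simp add: algebra_simps flip: exp_add)
      also have "\<dots> = integral {-Y..Y} (\<lambda>y. G (\<i> * of_real y) * exp (- (\<i> * of_real y * of_real x))) * exp (l * of_real x)"
        by simp
      finally show ?thesis by (simp add: inv_trunc_def)
    qed
    then show ?thesis by simp
  qed
  also have "integral {\<gamma>..\<beta>} (\<lambda>x. integral {-Y..Y} (\<lambda>y. G (\<i> * of_real y) * exp ((l - \<i> * of_real y) * of_real x))) =
     integral {-Y..Y} (\<lambda>y. integral {\<gamma>..\<beta>} (\<lambda>x. G (\<i> * of_real y) * exp ((l - \<i> * of_real y) * of_real x)))"
  proof -
    have "continuous_on (cbox (\<gamma>,-Y) (\<beta>,Y)) (\<lambda>x::real\<times>real. G (\<i> * of_real (snd x)))"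
      by (rule continuous_on_compose2[OF cG[of UNIV]]) (auto intro!: continuous_intros)
    then have "continuous_on (cbox (\<gamma>,-Y) (\<beta>,Y)) (\<lambda>(x, y). G (\<i> * of_real y) * exp ((l - \<i> * of_real y) * of_real x))"
      unfolding split_def by (intro continuous_intros) auto
    from integral_swap_continuous[OF this] show ?thesis by simp
  qed
  also have "\<dots> = integral {-Y..Y} (\<lambda>y. E \<gamma> (Complex 0 y) - E \<beta> (Complex 0 y))"
  proof (rule integral_cong)
    fix y
    have "Complex 0 y = \<i> * of_real y" by (simp add: complex_eq_iff)
    then show "integral {\<gamma>..\<beta>} (\<lambda>x. G (\<i> * of_real y) * exp ((l - \<i> * of_real y) * of_real x)) =
      E \<gamma> (Complex 0 y) - E \<beta> (Complex 0 y)"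
      using lny[of y] by (simp add: expint E_def) (simp add: divide_simps, simp add: algebra_simps)
  qed
  also have "\<dots> = integral {-Y..Y} (\<lambda>y. E \<gamma> (Complex 0 y)) - integral {-Y..Y} (\<lambda>y. E \<beta> (Complex 0 y))"
  proof -
    have *: "Complex 0 y - l \<noteq> 0" for y using l by (auto simp: complex_eq_iff)
    have cx: "continuous_on {-Y..Y} (\<lambda>y. Complex 0 y)"
      by (auto simp: Complex_eq intro!: continuous_intros)
    have "continuous_on {-Y..Y} (\<lambda>y. G (Complex 0 y))"
      by (rule continuous_on_compose2[OF cG[of UNIV] cx]) auto
    then have "(\<lambda>y. E c (Complex 0 y)) integrable_on {-Y..Y}" for c
      unfolding E_def using * cx by (intro integrable_continuous_real continuous_intros) auto
    then show ?thesis by (intro integral_diff)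
  qed
  finally have I: "integral {\<gamma>..\<beta>} (\<lambda>x. inv_trunc G Y x * exp (l * of_real x)) =
    (integral {-Y..Y} (\<lambda>y. E \<gamma> (Complex 0 y)) - integral {-Y..Y} (\<lambda>y. E \<beta> (Complex 0 y))) / (2 * of_real pi)" .
  let ?L = "part_circlepath 0 Y (pi/2) (3/2*pi)"
  have seg: "\<i> * integral {-Y..Y} (\<lambda>y. E c (Complex 0 y)) = - contour_integral ?L (E c)" for c
  proof -
    have "E c holomorphic_on {z. Re z < Re l}"
      unfolding E_def using hol holomorphic_on_subset by (intro holomorphic_intros) auto
    from Cauchy_left_half_circle[OF this l(1) Y]
    show ?thesis by (subst (asm) contour_integral_linepath_same_Re[where c=0 and a="-Y" and b=Y]) (use Y in auto)
  qed
  \<comment> \<open>The factor exp(c Re z) of the growth hypothesis cancels against the kernel; on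
    norm z = Y only powers of Y remain, and they beat the length of the arc.\<close>
  have nE: "norm (E c z) \<le> C * exp (c * Re l) / ((1 + Y\<^sup>2) * (Y - norm l))"
    if z: "norm z = Y" and b: "norm (G z) \<le> C * exp (c * Re z) / (1 + (norm z)\<^sup>2)" for c z
  proof -
    have d: "norm (z - l) \<ge> Y - norm l" using z norm_triangle_ineq2[of z l] by simp
    have "norm (E c z) = norm (G z) * exp ((Re l - Re z) * c) / norm (z - l)"
      by (simp add: E_def norm_mult norm_divide)
    also have "\<dots> \<le> (C * exp (c * Re z) / (1 + (norm z)\<^sup>2)) * exp ((Re l - Re z) * c) / (Y - norm l)"
      using b d l(2) C by (intro frac_le mult_right_mono) (auto intro!: divide_nonneg_nonneg mult_nonneg_nonneg add_nonneg_nonneg)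
    also have "\<dots> = C * (exp (c * Re z) * exp ((Re l - Re z) * c)) / ((1 + Y\<^sup>2) * (Y - norm l))"
      using z by simp
    also have "exp (c * Re z) * exp ((Re l - Re z) * c) = exp (c * Re l)"
      by (simp flip: exp_add) (simp add: algebra_simps)
    finally show ?thesis .
  qed
  have Lbd: "norm (contour_integral ?L (E \<gamma>)) \<le> C * exp (\<gamma> * Re l) / ((1 + Y\<^sup>2) * (Y - norm l)) * Y * \<bar>3/2*pi - pi/2\<bar>"
  proof (rule contour_integral_bound_part_circlepath)
    have im: "z \<in> path_image ?L \<Longrightarrow> norm z = Y \<and> Re z \<le> 0" for z
    proof -
      assume "z \<in> path_image ?L"
      then obtain t where t: "pi/2 \<le> t" "t \<le> 3/2*pi" and z: "z = 0 + of_real Y * cis t"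
        by (auto simp: path_image_part_circlepath' rcis_def closed_segment_eq_real_ivl image_iff)
      have "cos t = - cos (t - pi)" by simp
      moreover have "cos (t - pi) \<ge> 0" using t by (intro cos_ge_zero) auto
      ultimately have "Y * cos t \<le> 0" using Y by (simp add: mult_le_0_iff)
      then show ?thesis using z Y by (simp add: norm_mult)
    qed
    then show "x \<in> path_image ?L \<Longrightarrow> norm (E \<gamma> x) \<le> C * exp (\<gamma> * Re l) / ((1 + Y\<^sup>2) * (Y - norm l))" for x
      using nE left by blast
    show "E \<gamma> contour_integrable_on ?L"
      unfolding E_def using im l
      by (intro contour_integrable_continuous_part_circlepath continuous_intros cG) fastforce
    show "0 \<le> C * exp (\<gamma> * Re l) / ((1 + Y\<^sup>2) * (Y - norm l))" using C l by simp
  qed (use Y in auto)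
  let ?Q1 = "part_circlepath 0 Y 0 (pi/2)" and ?Q4 = "part_circlepath 0 Y (3/2*pi) (2*pi)"
  have Qbd: "norm (contour_integral (part_circlepath 0 Y s t) (E \<beta>)) \<le>
      C * exp (\<beta> * Re l) / ((1 + Y\<^sup>2) * (Y - norm l)) * Y * \<bar>t - s\<bar>"
    if st: "s \<le> t" "\<And>u. s \<le> u \<Longrightarrow> u \<le> t \<Longrightarrow> cos u \<ge> 0" for s t
  proof (rule contour_integral_bound_part_circlepath)
    let ?L = "part_circlepath 0 Y s t"
    have im: "z \<in> path_image ?L \<Longrightarrow> norm z = Y \<and> Re z \<ge> 0" for z
    proof -
      assume "z \<in> path_image ?L"
      then obtain u where u: "s \<le> u" "u \<le> t" and z: "z = 0 + of_real Y * cis u"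
        using st(1) by (auto simp: path_image_part_circlepath' rcis_def closed_segment_eq_real_ivl image_iff)
      then show ?thesis using st(2)[OF u] Y by (simp add: norm_mult)
    qed
    then show "x \<in> path_image ?L \<Longrightarrow> norm (E \<beta> x) \<le> C * exp (\<beta> * Re l) / ((1 + Y\<^sup>2) * (Y - norm l))" for x
      using nE right by blast
    show "E \<beta> contour_integrable_on ?L"
      unfolding E_def using im l
      by (intro contour_integrable_continuous_part_circlepath continuous_intros cG) fastforce
    show "0 \<le> C * exp (\<beta> * Re l) / ((1 + Y\<^sup>2) * (Y - norm l))" using C l by simp
  qed (use Y in auto)
  have Q1: "norm (contour_integral ?Q1 (E \<beta>)) \<le>  C * exp (\<beta> * Re l) / ((1 + Y\<^sup>2) * (Y - norm l)) * Y * \<bar>pi/2 - 0\<bar>"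
    by (rule Qbd) (auto intro: cos_ge_zero)
  have Q4: "norm (contour_integral ?Q4 (E \<beta>)) \<le>  C * exp (\<beta> * Re l) / ((1 + Y\<^sup>2) * (Y - norm l)) * Y * \<bar>2*pi - 3/2*pi\<bar>"
  proof (rule Qbd)
    fix u assume u: "3/2*pi \<le> u" "u \<le> 2*pi"
    have "cos (2*pi - u) \<ge> 0" using u by (intro cos_ge_zero) auto
    then show "cos u \<ge> 0" by simp
  qed auto
  \<comment> \<open>On the left arc the hypothesis controls only \<open>E \<gamma>\<close>. The left
    arc of \<open>E \<beta>\<close> is therefore traded for the two quarter arcs on the right and
    the value \<open>G l\<close>.\<close>
  have full: "contour_integral ?Q1 (E \<beta>) + contour_integral ?L (E \<beta>) + contour_integral ?Q4 (E \<beta>) = 2 * of_real pi * \<i> * G l"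
  proof -
    have h: "((\<lambda>u. (G u * exp ((l - u) * of_real \<beta>))/(u-l)) has_contour_integral
        (2 * of_real pi * \<i> * (G l * exp ((l - l) * of_real \<beta>)))) (circlepath 0 Y)"
      by (rule Cauchy_integral_circlepath_simple)
         (use l hol holomorphic_on_subset in \<open>auto intro!: holomorphic_intros\<close>)
    then have i: "E \<beta> contour_integrable_on part_circlepath 0 Y 0 (2*pi)"
       and v: "contour_integral (part_circlepath 0 Y 0 (2*pi)) (E \<beta>) = 2 * of_real pi * \<i> * G l"
      unfolding E_def circlepath_def by (auto simp: contour_integrable_on_def contour_integral_unique)
    have "E \<beta> contour_integrable_on part_circlepath 0 Y (pi/2) (2*pi)"
      using i by (auto simp: contour_integrable_part_circlepath_iff intro: integrable_on_subinterval)
    then show ?thesis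
      using v contour_integral_part_circlepath_split[OF i, of "pi/2"]
        contour_integral_part_circlepath_split[of "E \<beta>" 0 Y "pi/2" "2*pi" "3/2*pi"] by (simp add: add.assoc)
  qed
  have "integral {\<gamma>..\<beta>} (\<lambda>x. inv_trunc G Y x * exp (l * of_real x)) - G l =
     \<i> * (contour_integral ?L (E \<gamma>) + contour_integral ?Q1 (E \<beta>) + contour_integral ?Q4 (E \<beta>)) / (2 * of_real pi)"
  proof -
    have iv: "integral {-Y..Y} (\<lambda>y. E c (Complex 0 y)) = \<i> * contour_integral ?L (E c)" for c
    proof -
      have "\<i> * (\<i> * integral {-Y..Y} (\<lambda>y. E c (Complex 0 y))) = \<i> * (- contour_integral ?L (E c))"
        using seg by simp
      then show ?thesis by (simp flip: mult.assoc)
    qed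
    have alg: "(\<i> * a - \<i> * b) / (2 * of_real pi) - g = \<i> * (a + p + q) / (2 * of_real pi)"
      if "p + b + q = 2 * of_real pi * \<i> * g" for a b p q g
    proof -
      have "\<i> * (p + b + q) = - (2 * of_real pi * g)"
        unfolding that by (metis ab_semigroup_mult_class.mult_ac(1) complex_i_mult_minus mult.left_commute)
      then have "\<i> * a - \<i> * b = \<i> * (a + p + q) + 2 * of_real pi * g"
        by (simp add: algebra_simps eq_neg_iff_add_eq_0)
      then show ?thesis by (simp add: add_divide_distrib)
    qed
    show ?thesis unfolding I iv by (rule alg[OF full])
  qed
  then have "norm (integral {\<gamma>..\<beta>} (\<lambda>x. inv_trunc G Y x * exp (l * of_real x)) - G l) =
     norm (contour_integral ?L (E \<gamma>) + contour_integral ?Q1 (E \<beta>) + contour_integral ?Q4 (E \<beta>)) / (2 * pi)"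
    by (simp add: norm_mult norm_divide)
  also have "\<dots> \<le> (C * exp (\<gamma> * Re l) / ((1 + Y\<^sup>2) * (Y - norm l)) * Y * pi + C * exp (\<beta> * Re l) / ((1 + Y\<^sup>2) * (Y - norm l)) * Y * pi) / (2*pi)"
  proof (rule divide_right_mono)
    have "norm (contour_integral ?L (E \<gamma>) + contour_integral ?Q1 (E \<beta>) + contour_integral ?Q4 (E \<beta>)) \<le>
       norm (contour_integral ?L (E \<gamma>)) + norm (contour_integral ?Q1 (E \<beta>)) + norm (contour_integral ?Q4 (E \<beta>))"
      by (metis add_right_mono norm_triangle_ineq norm_triangle_le)
    also have "\<dots> \<le> C * exp (\<gamma> * Re l) / ((1 + Y\<^sup>2) * (Y - norm l)) * Y * \<bar>3/2*pi - pi/2\<bar> +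
        C * exp (\<beta> * Re l) / ((1 + Y\<^sup>2) * (Y - norm l)) * Y * \<bar>pi/2 - 0\<bar> + 
        C * exp (\<beta> * Re l) / ((1 + Y\<^sup>2) * (Y - norm l)) * Y * \<bar>2*pi - 3/2*pi\<bar>"
      using Lbd Q1 Q4 by linarith
    also have "\<dots> = C * exp (\<gamma> * Re l) / ((1 + Y\<^sup>2) * (Y - norm l)) * Y * pi + C * exp (\<beta> * Re l) / ((1 + Y\<^sup>2) * (Y - norm l)) * Y * pi"
    proof -
      have *: "u * \<bar>3/2*pi - pi/2\<bar> + v * \<bar>pi/2 - 0\<bar> + v * \<bar>2*pi - 3/2*pi\<bar> = u * pi + v * pi" for u v
        by (simp add: field_simps)
      show ?thesis by (rule *)
    qed
    finally show "norm (contour_integral ?L (E \<gamma>) + contour_integral ?Q1 (E \<beta>) + contour_integral ?Q4 (E \<beta>)) \<le> C * exp (\<gamma> * Re l) / ((1 + Y\<^sup>2) * (Y - norm l)) * Y * pi + C * exp (\<beta> * Re l) / ((1 + Y\<^sup>2) * (Y - norm l)) * Y * pi" .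
  qed auto
  also have "\<dots> = C * (exp (\<beta> * Re l) + exp (\<gamma> * Re l)) / (Y - norm l) * (Y / (2 * (1 + Y\<^sup>2)))"
    by (simp add: divide_simps) (simp add: algebra_simps)
  also have "\<dots> \<le> C * (exp (\<beta> * Re l) + exp (\<gamma> * Re l)) / (Y - norm l) * 1"
  proof (rule mult_left_mono)
    have "0 \<le> (Y-1)\<^sup>2" by simp
    then have "2 * Y \<le> 1 + Y\<^sup>2" by (simp add: power2_diff)
    moreover have "1 + Y\<^sup>2 \<le> 2 * (1 + Y\<^sup>2)" by simp
    ultimately have "Y \<le> 2 * (1 + Y\<^sup>2)" using Y by (meson order_trans mult_le_cancel_right1 one_le_numeral less_imp_le not_less)
    then show "Y / (2 * (1 + Y\<^sup>2)) \<le> 1" by (simp add: divide_le_eq add_pos_nonneg)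
    show "0 \<le> C * (exp (\<beta> * Re l) + exp (\<gamma> * Re l)) / (Y - norm l)" using C l by (simp add: add_nonneg_nonneg)
  qed
  finally show ?thesis by simp
qed

text \<open>Truncated inversion gives densities bounded by \<open>C / 2\<close> whose transforms
  tend to \<open>G\<close>; pairing with x^j exp(lx) is the j-th derivative of the transform at l.
  The constant \<open>C'\<close> enters only the error that tends to 0, so the final bound involves
  the axis constant \<open>C\<close> alone. This is what later allows \<open>C'\<close> to depend on
  the length of the products.\<close>

lemma laplace_functional_bound:
  fixes G :: "complex \<Rightarrow> complex" and c l :: "'i \<Rightarrow> complex" and j :: "'i \<Rightarrow> nat"
  assumes hol: "G holomorphic_on UNIV" and gb: "\<gamma> \<le> \<beta>"
    and right: "\<And>z. Re z \<ge> 0 \<Longrightarrow> norm (G z) \<le> C' * exp (\<beta> * Re z) / (1 + (norm z)\<^sup>2)"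
    and left: "\<And>z. Re z \<le> 0 \<Longrightarrow> norm (G z) \<le> C' * exp (\<gamma> * Re z) / (1 + (norm z)\<^sup>2)"
    and axis: "\<And>y::real. norm (G (\<i> * of_real y)) \<le> C / (1 + y\<^sup>2)"
    and l: "\<And>i. i \<in> I \<Longrightarrow> Re (l i) > 0" and I: "finite I"
    and B: "\<And>x. x \<in> {\<gamma>..\<beta>} \<Longrightarrow> norm (\<Sum>i\<in>I. c i * (of_real x ^ j i * exp (l i * of_real x))) \<le> B"
  shows "norm (\<Sum>i\<in>I. c i * (deriv ^^ j i) G (l i)) \<le> C / 2 * B * (\<beta> - \<gamma>)"
proof -
  have C'0: "C' \<ge> 0" using right[of 0] order_trans[OF norm_ge_zero] by fastforce
  have C0: "C \<ge> 0" using axis[of 0] order_trans[OF norm_ge_zero] by fastforce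
  have cG: "continuous_on S G" for S
    using hol holomorphic_on_imp_continuous_on continuous_on_subset by blast
  define \<Phi> where "\<Phi> n w = integral {\<gamma>..\<beta>} (\<lambda>x. inv_trunc G (real n) x * exp (w * of_real x))" for n w
  have lim: "(\<lambda>n. (deriv ^^ k) (\<Phi> n) w) \<longlonglongrightarrow> (deriv ^^ k) G w" if w: "Re w > 0" for w k
  proof -
    define \<rho> where "\<rho> = norm w + 1"
    \<comment> \<open>On this open half-disc the inversion error is uniform, so the convergence
      carries over to all derivatives at \<open>w\<close>.\<close>
    define A where "A = {z. 0 < Re z} \<inter> ball 0 \<rho>"
    define K where "K = C' * (exp (\<bar>\<beta>\<bar> * \<rho>) + exp (\<bar>\<gamma>\<bar> * \<rho>))"
    have err: "norm (\<Phi> n z - G z) \<le> K / (real n - \<rho>)" if "z \<in> A" "real n > \<rho>" for n z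
    proof -
      have z: "Re z > 0" "norm z < \<rho>" using that by (auto simp: A_def)
      have "norm (\<Phi> n z - G z) \<le> C' * (exp (\<beta> * Re z) + exp (\<gamma> * Re z)) / (real n - norm z)"
        unfolding \<Phi>_def
        by (rule laplace_inv_trunc_error[OF hol gb C'0]) (use right left z that in auto)
      also have "\<dots> \<le> K / (real n - \<rho>)"
      proof -
        have "t * Re z \<le> \<bar>t\<bar> * \<rho>" for t
        proof -
          have "\<bar>t * Re z\<bar> \<le> \<bar>t\<bar> * \<rho>"
            unfolding abs_mult using abs_Re_le_cmod[of z] z by (intro mult_left_mono) auto
          then show ?thesis by linarith
        qed
        then show ?thesis unfolding K_def using z that C'0
          by (intro frac_le mult_left_mono add_mono) (auto simp: add_nonneg_nonneg)
      qed
      finally show ?thesis .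
    qed
    have "filterlim (\<lambda>n. real n - \<rho>) at_top sequentially"
      using filterlim_tendsto_add_at_top[OF tendsto_const[of "-\<rho>"] filterlim_real_sequentially]
      by simp
    then have K0: "(\<lambda>n. K / (real n - \<rho>)) \<longlonglongrightarrow> 0"
      by (intro tendsto_divide_0[OF tendsto_const] filterlim_at_top_imp_at_infinity)
    have ul: "uniform_limit A \<Phi> G sequentially"
      unfolding uniform_limit_iff
    proof (intro allI impI)
      fix e :: real assume e: "e > 0"
      have "\<forall>\<^sub>F n in sequentially. real n > \<rho>"
        using filterlim_real_sequentially by (simp add: filterlim_at_top_dense)
      moreover have "\<forall>\<^sub>F n in sequentially. K / (real n - \<rho>) < e"
        using order_tendstoD(2)[OF K0 e] .
      ultimately show "\<forall>\<^sub>F n in sequentially. \<forall>z\<in>A. dist (\<Phi> n z) (G z) < e"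
        by eventually_elim (use err in \<open>fastforce simp: dist_norm\<close>)
    qed
    show ?thesis
    proof (rule higher_deriv_complex_uniform_limit[OF ul])
      have "\<Phi> n holomorphic_on UNIV" for n
        unfolding \<Phi>_def using laplace_holomorphic[OF continuous_inv_trunc[OF cG]] .
      then show "\<forall>\<^sub>F n in sequentially. \<Phi> n holomorphic_on A"
        using holomorphic_on_subset by (intro always_eventually) blast
      show "open A" unfolding A_def by (intro open_Int open_halfspace_Re_gt) auto
      show "w \<in> A" using w by (auto simp: A_def \<rho>_def)
    qed auto
  qed
  have bd: "norm (\<Sum>i\<in>I. c i * (deriv ^^ j i) (\<Phi> n) (l i)) \<le> C / 2 * B * (\<beta> - \<gamma>)" for n
  proof -
    have hc: "continuous_on {\<gamma>..\<beta>} (inv_trunc G (real n))" by (rule continuous_inv_trunc[OF cG])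
    let ?f = "\<lambda>x. \<Sum>i\<in>I. c i * (complex_of_real x ^ j i * exp (l i * of_real x))"
    have "(\<Sum>i\<in>I. c i * (deriv ^^ j i) (\<Phi> n) (l i)) =
       (\<Sum>i\<in>I. integral {\<gamma>..\<beta>} (\<lambda>x. c i * (inv_trunc G (real n) x * of_real x ^ j i * exp (l i * of_real x))))"
      unfolding \<Phi>_def by (simp add: laplace_higher_deriv[OF hc])
    also have "\<dots> = integral {\<gamma>..\<beta>} (\<lambda>x. \<Sum>i\<in>I. c i * (inv_trunc G (real n) x * of_real x ^ j i * exp (l i * of_real x)))"
      by (intro integral_sum[symmetric] I integrable_continuous_real continuous_intros hc)
    also have "\<dots> = integral {\<gamma>..\<beta>} (\<lambda>x. inv_trunc G (real n) x * ?f x)"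
      by (simp add: sum_distrib_left mult_ac)
    also have "norm \<dots> \<le> C / 2 * B * (\<beta> - \<gamma>)"
    proof (rule integral_bound[OF gb])
      show "continuous_on {\<gamma>..\<beta>} (\<lambda>x. inv_trunc G (real n) x * ?f x)"
        by (intro continuous_intros hc)
      show "norm (inv_trunc G (real n) x * ?f x) \<le> C / 2 * B" if "x \<in> {\<gamma>..\<beta>}" for x
        unfolding norm_mult
        using norm_inv_trunc_le[OF cG C0 axis] B[OF that] C0 by (intro mult_mono) auto
    qed
    finally show ?thesis .
  qed
  have "(\<lambda>n. norm (\<Sum>i\<in>I. c i * (deriv ^^ j i) (\<Phi> n) (l i))) \<longlonglongrightarrow> norm (\<Sum>i\<in>I. c i * (deriv ^^ j i) G (l i))"
    by (intro tendsto_intros lim l)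
  then show ?thesis using bd by (intro LIMSEQ_le_const2) auto
qed

section \<open>Uniform interpolation\<close>

lemma Baire_closed_cover:
  fixes X :: "nat \<Rightarrow> 'a::metric_space set"
  assumes "complete (UNIV :: 'a set)" and cl: "\<And>n. closed (X n)" and cov: "(\<Union>n. X n) = UNIV"
  obtains n x r where "r > 0" "ball x r \<subseteq> X n"
proof -
  have "\<exists>n. interior (X n) \<noteq> {}"
  proof (rule ccontr)
    assume "\<nexists>n. interior (X n) \<noteq> {}"
    then have "Met_TC.mtopology interior_of \<Union>(range X) = {}"
      using cl assms(1) by (intro Met_TC.metric_Baire_category_alt) auto
    then show False using cov by simp
  qed
  then obtain n x where "x \<in> interior (X n)" by blast
  then show thesis using that by (auto simp: mem_interior)
qed

text \<open>Every function on the discrete space \<open>nat\<close> is continuous, so this type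
  models the bounded complex sequences, the data space to which Baire's theorem is applied.\<close>

lemma complete_bcontfun_nat: "complete (UNIV :: (nat \<Rightarrow>\<^sub>C complex) set)"
  unfolding complete_def
proof (intro allI impI, elim conjE)
  fix f :: "nat \<Rightarrow> (nat \<Rightarrow>\<^sub>C complex)"
  assume "Cauchy f"
  have "\<exists>N. \<forall>m n x. N \<le> m \<and> N \<le> n \<and> True \<longrightarrow> dist (f m x) (f n x) < e" if e: "e > 0" for e
  proof -
    obtain N where "\<And>m n. N \<le> m \<Longrightarrow> N \<le> n \<Longrightarrow> dist (f m) (f n) < e"
      using metric_CauchyD[OF \<open>Cauchy f\<close> e] by (metis (no_types))
    then show ?thesis by (intro exI[of _ N]) (simp add: dist_fun_lt_imp_dist_val_lt)
  qed
  then have "\<forall>e>0. \<exists>N. \<forall>m n x. N \<le> m \<and> N \<le> n \<and> True \<longrightarrow> dist (f m x) (f n x) < e"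
    by (intro allI impI)
  then obtain g where "\<forall>e>0. \<exists>N. \<forall>n x. N \<le> n \<and> True \<longrightarrow> dist (f n x) (g x) < e"
    using uniformly_convergent_eq_cauchy[of "\<lambda>_. True" "\<lambda>n. apply_bcontfun (f n)"] by auto
  then have "uniform_limit UNIV (\<lambda>n. apply_bcontfun (f n)) g sequentially"
    unfolding uniform_limit_sequentially_iff by simp
  then obtain l where "f \<longlonglongrightarrow> l"
    by (rule uniform_limit_bcontfunE[OF _ sequentially_bot])
  then show "\<exists>l\<in>UNIV. f \<longlonglongrightarrow> l" by (rule bexI) simp
qed

lemma bcontfun_discrete:
  fixes f :: "nat \<Rightarrow> complex"
  assumes "\<And>x. norm (f x) \<le> b"
  shows "apply_bcontfun (Bcontfun f) = f"
  using assms by (intro Bcontfun_inverse bcontfun_normI) auto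

text \<open>In contrast to \<open>A0\<close>, both the exponent and the constant are fixed. The
  solutions then form a normal family, which is what makes the sets in the Baire argument
  closed.\<close>

definition interp_bounded :: "(nat \<Rightarrow> complex) \<Rightarrow> (nat \<Rightarrow> nat) \<Rightarrow> real \<Rightarrow> real \<Rightarrow> (nat \<Rightarrow> nat \<Rightarrow> complex) \<Rightarrow> (complex \<Rightarrow> complex) \<Rightarrow> bool"
  where "interp_bounded lam mu \<epsilon> M a f \<longleftrightarrow> f holomorphic_on UNIV \<and>
    (\<forall>z. norm (f z) \<le> M * exp (\<epsilon> * norm z)) \<and>
    (\<forall>n. \<forall>k<mu n. (deriv ^^ k) f (lam n) / of_nat (fact k) = a n k)"

text \<open>The common bound allows Montel's theorem; a locally uniform limit of a subsequence keeps
  the bound, and its derivatives at the nodes are the limits of the given ones.\<close>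

lemma interp_bounded_limit:
  assumes f: "\<And>i. interp_bounded lam mu \<epsilon> M (a i) (f i)"
    and lim: "\<And>n k. k < mu n \<Longrightarrow> (\<lambda>i. a i n k) \<longlonglongrightarrow> b n k"
  shows "\<exists>g. interp_bounded lam mu \<epsilon> M b g"
proof -
  have M: "M \<ge> 0"
  proof -
    have "norm (f 0 0) \<le> M * exp (\<epsilon> * norm (0::complex))"
      using f unfolding interp_bounded_def by blast
    then show ?thesis using norm_ge_zero[of "f 0 0"] by (simp del: norm_ge_zero)
  qed
  obtain g r where g: "g holomorphic_on UNIV" and r: "strict_mono (r::nat\<Rightarrow>nat)"
    and pt: "\<And>x. (\<lambda>n. f (r n) x) \<longlonglongrightarrow> g x"
    and ul: "\<And>K. compact K \<Longrightarrow> uniform_limit K (f \<circ> r) g sequentially"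
  proof (rule Montel[of UNIV "range f" f])
    fix K :: "complex set" assume "compact K"
    then obtain R where R: "\<And>z. z \<in> K \<Longrightarrow> norm z \<le> R"
      using compact_imp_bounded bounded_iff by metis
    have "norm (f i z) \<le> M * exp (\<bar>\<epsilon>\<bar> * R)" if "z \<in> K" for i z
    proof -
      have "\<epsilon> * norm z \<le> \<bar>\<epsilon>\<bar> * R" using R[OF that] by (intro mult_mono) auto
      then have "M * exp (\<epsilon> * norm z) \<le> M * exp (\<bar>\<epsilon>\<bar> * R)" using M by (intro mult_left_mono) auto
      moreover have "norm (f i z) \<le> M * exp (\<epsilon> * norm z)" using f by (auto simp: interp_bounded_def)
      ultimately show ?thesis by linarith
    qed
    then show "\<exists>B. \<forall>h\<in>range f. \<forall>z\<in>K. norm (h z) \<le> B" by auto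
  qed (use f in \<open>auto simp: interp_bounded_def\<close>)
  have "norm (g z) \<le> M * exp (\<epsilon> * norm z)" for z
    using f by (intro LIMSEQ_le_const2[OF tendsto_norm[OF pt[of z]]]) (auto simp: interp_bounded_def)
  moreover have "(deriv ^^ k) g (lam n) / of_nat (fact k) = b n k" if k: "k < mu n" for n k
  proof (rule LIMSEQ_unique)
    have "uniform_limit (ball (lam n) 1) (f \<circ> r) g sequentially"
      using ul[of "cball (lam n) 1"] by (rule uniform_limit_on_subset) auto
    then have "(\<lambda>i. (deriv ^^ k) ((f \<circ> r) i) (lam n)) \<longlonglongrightarrow> (deriv ^^ k) g (lam n)"
    proof (rule higher_deriv_complex_uniform_limit)
      show "\<forall>\<^sub>F i in sequentially. (f \<circ> r) i holomorphic_on ball (lam n) 1"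
        using f by (intro always_eventually) (auto simp: interp_bounded_def intro: holomorphic_on_subset)
    qed auto
    then show "(\<lambda>i. (deriv ^^ k) ((f \<circ> r) i) (lam n) / of_nat (fact k)) \<longlonglongrightarrow> (deriv ^^ k) g (lam n) / of_nat (fact k)"
      by (intro tendsto_divide) auto
    have "(\<lambda>i. a (r i) n k) \<longlonglongrightarrow> b n k"
      using LIMSEQ_subseq_LIMSEQ[OF lim[OF k] r] by (simp add: o_def)
    moreover have "(deriv ^^ k) ((f \<circ> r) i) (lam n) / of_nat (fact k) = a (r i) n k" for i
      using f k by (auto simp: interp_bounded_def)
    ultimately show "(\<lambda>i. (deriv ^^ k) ((f \<circ> r) i) (lam n) / of_nat (fact k)) \<longlonglongrightarrow> b n k"
      by presburger
  qed
  ultimately show ?thesis using g by (auto simp: interp_bounded_def)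
qed

text \<open>Moves a solvable ball of data from its centre to the origin and rescales it, at the cost
  of a factor 2.\<close>

lemma interp_bounded_diff:
  assumes f: "interp_bounded lam mu \<epsilon> M a f" and g: "interp_bounded lam mu \<epsilon> M b g"
  shows "interp_bounded lam mu \<epsilon> (norm c * (2 * M)) (\<lambda>n k. c * (a n k - b n k)) (\<lambda>z. c * (f z - g z))"
proof -
  have hol: "f holomorphic_on UNIV" "g holomorphic_on UNIV"
    using f g by (auto simp: interp_bounded_def)
  have "norm (c * (f z - g z)) \<le> norm c * (2 * M) * exp (\<epsilon> * norm z)" for z
  proof -
    have "norm (f z - g z) \<le> M * exp (\<epsilon> * norm z) + M * exp (\<epsilon> * norm z)"
      using f g norm_triangle_ineq4[of "f z" "g z"] unfolding interp_bounded_def by (smt (verit))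
    then have "norm c * norm (f z - g z) \<le> norm c * (2 * M * exp (\<epsilon> * norm z))"
      by (intro mult_left_mono) auto
    then show ?thesis by (simp add: norm_mult mult_ac)
  qed
  moreover have "(deriv ^^ k) (\<lambda>z. c * (f z - g z)) w = c * ((deriv ^^ k) f w - (deriv ^^ k) g w)" for k w
    using hol higher_deriv_cmult[of "\<lambda>z. f z - g z" UNIV w k c] higher_deriv_diff[of f UNIV g w k]
    by (simp add: holomorphic_on_diff)
  moreover have "c * (u - v) / w = c * (u / w - v / w)" for u v w :: complex
    by (metis diff_divide_distrib times_divide_eq_right)
  moreover have "(\<lambda>z. c * (f z - g z)) holomorphic_on UNIV"
    using hol by (intro holomorphic_intros)
  ultimately show ?thesis
    using f g unfolding interp_bounded_def by (simp del: of_nat_fact)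
qed

text \<open>Since the multiplicities grow subexponentially, every bounded sequence is admissible
  data, so the closed sets \<open>X M\<close> cover the space and one of them contains a ball.
  Perturbing its centre by a small multiple of a unit vector and subtracting the two solutions gives
  the unit jet with a constant independent of \<open>n\<close> and \<open>k\<close>.\<close>

lemma uniform_interpolation:
  assumes int: "interpolating_variety_A0 lam mu"
    and mu: "\<And>\<epsilon>. \<epsilon> > 0 \<Longrightarrow> \<exists>C. \<forall>n. real (mu n) \<le> C * exp (\<epsilon> * norm (lam n))"
    and \<epsilon>: "\<epsilon> > 0"
  shows "\<exists>M. \<forall>n. \<forall>k<mu n. \<exists>f. interp_bounded lam mu \<epsilon> M (\<lambda>m j. if m = n \<and> j = k then 1 else 0) f"
proof -
  \<comment> \<open>One sequence encodes the whole double array; using all pairs, not only those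
    with k < \<open>mu n\<close>, keeps the data space independent of \<open>mu\<close>.\<close>
  define dat :: "(nat \<Rightarrow>\<^sub>C complex) \<Rightarrow> nat \<Rightarrow> nat \<Rightarrow> complex"
    where "dat x n k = apply_bcontfun x (prod_encode (n, k))" for x n k
  define X where "X M = {x. \<exists>f. interp_bounded lam mu \<epsilon> (real M) (dat x) f}" for M
  have cl: "closed (X M)" for M
    unfolding closed_sequential_limits
  proof (intro allI impI, elim conjE)
    fix x l assume x: "\<forall>n. x n \<in> X M" and l: "x \<longlonglongrightarrow> l"
    from x have "\<forall>i. \<exists>f. interp_bounded lam mu \<epsilon> (real M) (dat (x i)) f"
      by (simp add: X_def)
    then obtain f where "\<And>i. interp_bounded lam mu \<epsilon> (real M) (dat (x i)) (f i)"
      using choice by meson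
    moreover have "(\<lambda>i. dat (x i) n k) \<longlonglongrightarrow> dat l n k" for n k
      unfolding dat_def using tendsto_uniform_limitI[OF tendsto_bcontfun_uniform_limit[OF l] UNIV_I] .
    ultimately have "\<exists>g. interp_bounded lam mu \<epsilon> (real M) (dat l) g"
      by (rule interp_bounded_limit)
    then show "l \<in> X M" by (simp add: X_def)
  qed
  have "\<exists>M. x \<in> X M" for x
  proof -
    have nx: "norm (dat x n k) \<le> norm x" for n k unfolding dat_def by (rule norm_bounded)
    have "bdd_above (range (\<lambda>n. (\<Sum>k<mu n. norm (dat x n k)) * exp (- e * norm (lam n))))" if e: "e > 0" for e
    proof -
      obtain C where C: "\<And>n. real (mu n) \<le> C * exp (e * norm (lam n))" using mu[OF e] by blast
      have "(\<Sum>k<mu n. norm (dat x n k)) * exp (- e * norm (lam n)) \<le> C * norm x" for n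
      proof -
        have "(\<Sum>k<mu n. norm (dat x n k)) \<le> real (mu n) * norm x"
          using sum_bounded_above[of "{..<mu n}" "\<lambda>k. norm (dat x n k)" "norm x"] nx by simp
        also have "\<dots> \<le> C * exp (e * norm (lam n)) * norm x" using C by (intro mult_right_mono) auto
        finally have "(\<Sum>k<mu n. norm (dat x n k)) * exp (- e * norm (lam n)) \<le>
           C * exp (e * norm (lam n)) * norm x * exp (- e * norm (lam n))"
          by (intro mult_right_mono) auto
        also have "\<dots> = C * norm x" by (simp add: exp_minus field_simps)
        finally show ?thesis .
      qed
      then show ?thesis by (auto simp: bdd_above_def)
    qed
    then obtain f where fA: "f \<in> A0" and f: "\<forall>n. \<forall>k<mu n. (deriv ^^ k) f (lam n) / of_nat (fact k) = dat x n k"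
      using int unfolding interpolating_variety_A0_def by blast
    obtain M where M: "\<And>z. norm (f z) \<le> M * exp (\<epsilon> * norm z)" using fA \<epsilon> unfolding A0_def by blast
    obtain N :: nat where N: "M \<le> real N" using real_arch_simple by blast
    have "norm (f z) \<le> real N * exp (\<epsilon> * norm z)" for z
      using M[of z] N by (meson exp_ge_zero mult_right_mono order_trans)
    then show ?thesis using fA f by (auto simp: X_def A0_def interp_bounded_def)
  qed
  then have cov: "(\<Union>n. X n) = UNIV" by blast
  obtain N x r where r: "r > 0" and b: "ball x r \<subseteq> X N"
    by (rule Baire_closed_cover[OF complete_bcontfun_nat cl cov])
  have "x \<in> X N" using b r by (meson centre_in_ball subsetD)
  then obtain g where g: "interp_bounded lam mu \<epsilon> (real N) (dat x) g"
    unfolding X_def by blast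
  show ?thesis
  proof (intro exI[of _ "norm (of_real (2/r) :: complex) * (2 * real N)"] allI impI)
    fix n k assume k: "k < mu n"
    \<comment> \<open>Half the radius keeps the perturbed centre inside the open ball; the factor
      \<open>2/r\<close> restores the unit jet.\<close>
    define e where "e = (\<lambda>i. if i = prod_encode (n, k) then of_real (r/2) else 0 :: complex)"
    have ne: "norm (e i) \<le> r/2" for i using r by (simp add: e_def)
    define E where "E = Bcontfun e"
    have E: "apply_bcontfun E = e" unfolding E_def using ne by (rule bcontfun_discrete)
    have "norm E \<le> r/2" by (rule norm_bound) (use ne E in simp)
    then have "x + E \<in> ball x r" using r by (simp add: dist_norm)
    then have "x + E \<in> X N" using b by (rule set_rev_mp)
    then obtain f where f: "interp_bounded lam mu \<epsilon> (real N) (dat (x + E)) f"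
      unfolding X_def by blast
    have eq: "of_real (2/r) * (dat (x + E) m j - dat x m j) = (if m = n \<and> j = k then 1 else 0)" for m j
    proof -
      have "dat (x + E) m j - dat x m j = e (prod_encode (m, j))"
        by (simp add: dat_def E plus_bcontfun.rep_eq)
      then show ?thesis using r by (simp add: e_def)
    qed
    show "\<exists>f. interp_bounded lam mu \<epsilon> (norm (of_real (2/r) :: complex) * (2 * real N)) (\<lambda>m j. if m = n \<and> j = k then 1 else 0) f"
      by (rule exI, rule interp_bounded_diff[OF f g, of "of_real (2/r)", unfolded eq])
  qed
qed

section \<open>Elementary estimates\<close>

text \<open>The minimum is bounded by 1 in a finite head and by \<open>R / r m\<close> in the tail,
  where the series is below \<open>\<eta>\<close>. Thus \<open>C\<close> depends on neither
  \<open>N\<close> nor \<open>R\<close>. Besides controlling the products, the lemma shows mu_n =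
  o(|lambda_n|) when R is |lambda_n|.\<close>

lemma sum_min_le:
  fixes r :: "nat \<Rightarrow> real" and mu :: "nat \<Rightarrow> nat"
  assumes sm: "summable (\<lambda>n. real (mu n) / r n)" and r: "\<And>n. r n > 0" and \<eta>: "\<eta> > 0"
  shows "\<exists>C. \<forall>N R. R \<ge> 0 \<longrightarrow> (\<Sum>m<N. real (mu m) * min 1 (R / r m)) \<le> C + \<eta> * R"
proof -
  obtain m0 where m0: "\<And>N. norm (\<Sum>m\<in>{m0..<N}. real (mu m) / r m) < \<eta>"
    using sm \<eta> unfolding summable_Cauchy by blast
  show ?thesis
  proof (intro exI[of _ "\<Sum>m<m0. real (mu m)"] allI impI)
    fix N and R :: real assume R: "R \<ge> 0"
    have "(\<Sum>m<N. real (mu m) * min 1 (R / r m)) \<le> (\<Sum>m\<in>{..<m0} \<union> {m0..<N}. real (mu m) * min 1 (R / r m))"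
      using R r by (intro sum_mono2) (auto intro!: mult_nonneg_nonneg simp: less_imp_le)
    also have "\<dots> = (\<Sum>m<m0. real (mu m) * min 1 (R / r m)) + (\<Sum>m\<in>{m0..<N}. real (mu m) * min 1 (R / r m))"
      by (intro sum.union_disjoint) auto
    also have "\<dots> \<le> (\<Sum>m<m0. real (mu m)) + (\<Sum>m\<in>{m0..<N}. R * (real (mu m) / r m))"
    proof (intro add_mono sum_mono)
      show "real (mu m) * min 1 (R / r m) \<le> real (mu m)" for m
        using mult_left_mono[of "min 1 (R / r m)" 1 "real (mu m)"] by simp
      show "real (mu m) * min 1 (R / r m) \<le> R * (real (mu m) / r m)" for m
        using mult_left_mono[of "min 1 (R / r m)" "R / r m" "real (mu m)"] by (simp add: mult_ac)
    qed
    also have "(\<Sum>m\<in>{m0..<N}. R * (real (mu m) / r m)) = R * (\<Sum>m\<in>{m0..<N}. real (mu m) / r m)"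
      by (simp only: sum_distrib_left)
    also have "\<dots> \<le> R * \<eta>" using m0[of N] R by (intro mult_left_mono) auto
    finally show "(\<Sum>m<N. real (mu m) * min 1 (R / r m)) \<le> (\<Sum>m<m0. real (mu m)) + \<eta> * R"
      by (simp add: mult.commute)
  qed
qed

lemma exp_minus_double_le:
  fixes x :: real
  assumes "0 \<le> x" "x \<le> 1/2"
  shows "exp (- (2 * x)) \<le> 1 - x"
proof -
  have "1 \<le> (1 + 2 * x) * (1 - x)"
    using assms mult_mono[of x "1/2" x x] by (simp add: algebra_simps)
  also have "\<dots> \<le> exp (2 * x) * (1 - x)"
    using assms exp_ge_add_one_self[of "2*x"] by (intro mult_right_mono) auto
  finally show ?thesis by (simp add: exp_minus field_simps)
qed

text \<open>Merges a bound near 0 with a constant bound elsewhere into the form summed by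
  \<open>sum_min_le\<close>. The coefficient is at least 2, as needed for x <= 1/2; for larger x the
  minimum is at least 1/2, and half the coefficient is 1 - ln \<open>\<kappa>\<close>.\<close>

lemma exp_lower_boundI:
  fixes q x \<kappa> :: real
  assumes \<kappa>: "0 < \<kappa>" "\<kappa> \<le> 1" and x: "0 \<le> x" and q: "\<kappa> \<le> q" and small: "x \<le> 1/2 \<Longrightarrow> 1 - x \<le> q"
  shows "exp (- (2 * (1 - ln \<kappa>) * min 1 x)) \<le> q"
proof -
  have ln: "ln \<kappa> \<le> 0" using \<kappa> by simp
  show ?thesis
proof (cases "x \<le> 1/2")
  case True
  have "2 * x \<le> 2 * (1 - ln \<kappa>) * min 1 x"
    using True x ln by (intro mult_mono) auto
  then have "exp (- (2 * (1 - ln \<kappa>) * min 1 x)) \<le> exp (- (2 * x))" by simp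
  also have "\<dots> \<le> q" using exp_minus_double_le[OF x True] small[OF True] by simp
  finally show ?thesis .
next
  case False
  define A m where "A = 2 * (1 - ln \<kappa>)" and "m = min 1 x"
  have "A * (1/2) \<le> A * m"
    using False ln by (intro mult_left_mono) (auto simp: A_def m_def)
  then have "- (A * m) \<le> ln \<kappa>" unfolding A_def by (simp add: algebra_simps)
  then have "- (2 * (1 - ln \<kappa>) * min 1 x) \<le> ln \<kappa>" by (simp only: A_def m_def)
  then have "exp (- (2 * (1 - ln \<kappa>) * min 1 x)) \<le> exp (ln \<kappa>)" by simp
  then show ?thesis using \<kappa> q by simp
qed
qed

section \<open>The entire function sinh w / w: growth, lower bounds in a sector, decay on the
  imaginary axis\<close>

definition sinhc :: "complex \<Rightarrow> complex" where
  "sinhc w = (if w = 0 then 1 else sinh w / w)"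

lemma holomorphic_sinhc: "sinhc holomorphic_on UNIV"
proof -
  have "(sinh has_field_derivative cosh 0) (at (0::complex))"
    by (auto intro!: derivative_eq_intros)
  then have d: "deriv sinh (0::complex) = 1" using DERIV_imp_deriv by fastforce
  have "(\<lambda>z. if z = 0 then deriv sinh 0 else (sinh z - sinh 0) / (z - 0)) holomorphic_on (UNIV::complex set)"
  proof (rule pole_lemma)
    show "sinh holomorphic_on (UNIV::complex set)"
      unfolding holomorphic_on_def field_differentiable_def
      by (auto intro!: exI derivative_eq_intros)
  qed auto
  then show ?thesis by (simp add: d sinhc_def[abs_def] cong: if_cong)
qed

lemma holomorphic_sinhc_compose [holomorphic_intros]:
  "f holomorphic_on S \<Longrightarrow> (\<lambda>z. sinhc (f z)) holomorphic_on S"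
  using holomorphic_on_compose_gen[OF _ holomorphic_sinhc, of f S] by (simp add: o_def)

lemma norm_sinh_le: "norm (sinh w) \<le> exp \<bar>Re w\<bar>" for w :: complex
proof -
  have "norm (sinh w) = norm (exp w - exp (-w)) / 2" by (simp add: sinh_field_def norm_divide)
  also have "\<dots> \<le> (exp (Re w) + exp (- Re w)) / 2"
    using norm_triangle_ineq4[of "exp w" "exp (-w)"] by simp
  also have "\<dots> \<le> (exp \<bar>Re w\<bar> + exp \<bar>Re w\<bar>) / 2" by (intro divide_right_mono add_mono) auto
  finally show ?thesis by simp
qed

lemma norm_cosh_le: "norm (cosh w) \<le> exp \<bar>Re w\<bar>" for w :: complex
proof -
  have "norm (cosh w) = norm (exp w + exp (-w)) / 2" by (simp add: cosh_field_def norm_divide)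
  also have "\<dots> \<le> (exp (Re w) + exp (- Re w)) / 2"
    using norm_triangle_ineq[of "exp w" "exp (-w)"] by simp
  also have "\<dots> \<le> (exp \<bar>Re w\<bar> + exp \<bar>Re w\<bar>) / 2" by (intro divide_right_mono add_mono) auto
  finally show ?thesis by simp
qed

lemma norm_sinh_le_mult: "norm (sinh w) \<le> norm w * exp \<bar>Re w\<bar>" for w :: complex
proof -
  have "norm (sinh w - sinh 0) \<le> exp \<bar>Re w\<bar> * norm (w - 0)"
  proof (rule field_differentiable_bound[of "closed_segment 0 w"])
    show "(sinh has_field_derivative cosh z) (at z within closed_segment 0 w)" for z
      by (auto intro!: derivative_eq_intros)
    fix z assume "z \<in> closed_segment 0 w"
    then obtain u where u: "0 \<le> u" "u \<le> 1" "z = u *\<^sub>R w" by (auto simp: in_segment)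
    then have "\<bar>Re z\<bar> \<le> \<bar>Re w\<bar>" by (simp add: abs_mult mult_left_le_one_le)
    then have "exp \<bar>Re z\<bar> \<le> exp \<bar>Re w\<bar>" by simp
    then show "norm (cosh z) \<le> exp \<bar>Re w\<bar>" using norm_cosh_le[of z] by linarith
  qed auto
  then show ?thesis by (simp add: mult.commute)
qed

lemma norm_sinhc_le: "norm (sinhc w) \<le> exp \<bar>Re w\<bar>"
  using norm_sinh_le_mult[of w] by (auto simp: sinhc_def norm_divide field_simps)

lemma norm_mult_sinhc_le: "norm w * norm (sinhc w) \<le> exp \<bar>Re w\<bar>"
  using norm_sinh_le[of w] by (auto simp: sinhc_def norm_divide)

text \<open>Two applications of the mean value inequality: a bound for sinh gives one for cosh - 1,
  which gives one for sinh w - w.\<close>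

lemma norm_sinhc_diff_1_le:
  assumes "norm w \<le> 1/2"
  shows "norm (sinhc w - 1) \<le> norm w"
proof -
  have sh: "norm (sinh z) \<le> 1" if "norm z \<le> 1/2" for z :: complex
  proof -
    have "exp \<bar>Re z\<bar> \<le> exp (1/2)" using abs_Re_le_cmod[of z] that by simp
    also have "\<dots> \<le> 2" by (rule exp_half_le2)
    finally have "norm z * exp \<bar>Re z\<bar> \<le> 1/2 * 2" using that by (intro mult_mono) auto
    then show ?thesis using norm_sinh_le_mult[of z] by simp
  qed
  have ch: "norm (cosh z - 1) \<le> norm z" if z: "norm z \<le> 1/2" for z :: complex
  proof -
    have "norm (cosh z - cosh 0) \<le> 1 * norm (z - 0)"
    proof (rule field_differentiable_bound[of "cball 0 (1/2)"])
      show "(cosh has_field_derivative sinh u) (at u within cball 0 (1/2))" for u :: complex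
        by (auto intro!: derivative_eq_intros)
      show "norm (sinh u) \<le> 1" if "u \<in> cball 0 (1/2)" for u :: complex
        using sh[of u] that by simp
    qed (use z in auto)
    then show ?thesis by simp
  qed
  have "norm ((sinh w - w) - (sinh 0 - 0)) \<le> norm w * norm (w - 0)"
  proof (rule field_differentiable_bound[of "cball 0 (norm w)"])
    show "((\<lambda>z. sinh z - z) has_field_derivative cosh z - 1) (at z within cball 0 (norm w))" for z :: complex
      by (auto intro!: derivative_eq_intros)
    show "norm (cosh z - 1) \<le> norm w" if "z \<in> cball 0 (norm w)" for z :: complex
      using ch[of z] that assms by simp
  qed auto
  then have "norm (sinh w - w) \<le> norm w * norm w" by simp
  then show ?thesis
    by (auto simp: sinhc_def divide_simps norm_divide simp flip: norm_divide)
       (simp add: diff_divide_eq_iff norm_divide divide_simps)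
qed

text \<open>In the sector |sinh w| >= sinh (Re w) >= Re w >= \<open>\<kappa>\<close> |w|, so the
  quotient never drops below \<open>\<kappa>\<close>; near 0 it is at least 1 - |w|. An exponent
  linear in |w| lets the bounds multiply along a product of given total type.\<close>

lemma norm_sinhc_ge:
  assumes \<kappa>: "0 < \<kappa>" "\<kappa> \<le> 1" and w: "\<kappa> * norm w \<le> Re w"
  shows "exp (- (2 * (1 - ln \<kappa>) * norm w)) \<le> norm (sinhc w)"
proof -
  have "\<kappa> \<le> norm (sinhc w)"
  proof (cases "w = 0")
    case False
    have Re0: "Re w \<ge> 0" using w \<kappa> by (meson mult_nonneg_nonneg norm_ge_zero order_trans less_imp_le)
    have "Re w \<le> (exp (Re w) - inverse (exp (Re w))) / 2" using real_le_x_sinh[OF Re0] .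
    also have "\<dots> = (norm (exp w) - norm (exp (-w))) / 2" by (simp add: exp_minus norm_inverse)
    also have "\<dots> \<le> norm (exp w - exp (-w)) / 2" by (intro divide_right_mono norm_triangle_ineq2) auto
    also have "\<dots> = norm (sinh w)" by (simp add: sinh_field_def norm_divide)
    finally have "\<kappa> * norm w \<le> norm (sinh w)" using w by simp
    then show ?thesis using False by (simp add: sinhc_def norm_divide field_simps)
  qed (use \<kappa> in \<open>simp add: sinhc_def\<close>)
  moreover have "1 - norm w \<le> norm (sinhc w)" if "norm w \<le> 1/2"
    using norm_sinhc_diff_1_le[OF that] norm_triangle_ineq2[of 1 "1 - sinhc w"]
    by (simp add: norm_minus_commute)
  ultimately have "exp (- (2 * (1 - ln \<kappa>) * min 1 (norm w))) \<le> norm (sinhc w)"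
    using \<kappa> by (intro exp_lower_boundI) auto
  moreover have "2 * (1 - ln \<kappa>) * min 1 (norm w) \<le> 2 * (1 - ln \<kappa>) * norm w"
  proof (rule mult_left_mono)
    have "ln \<kappa> \<le> 0" using \<kappa> by simp
    then show "0 \<le> 2 * (1 - ln \<kappa>)" by simp
  qed simp
  ultimately show ?thesis by (smt (verit) exp_le_cancel_iff)
qed

text \<open>The bounds for \<open>sinhc\<close> with and without the factor |w| are squared and
  added. The constant exceeds 1, so a bound uniform in \<open>N\<close> can afford it for finitely
  many factors only.\<close>

lemma one_plus_square_sinhc_le:
  assumes a: "a > 0"
  shows "(1 + (norm z)\<^sup>2) * (norm (sinhc (of_real a * z)))\<^sup>2 \<le> (1 + 1 / a\<^sup>2) * exp (2 * a * \<bar>Re z\<bar>)"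
proof -
  let ?s = "norm (sinhc (of_real a * z))"
  have e: "exp (2 * a * \<bar>Re z\<bar>) = (exp \<bar>Re (of_real a * z)\<bar>)\<^sup>2"
    using a by (simp add: abs_mult power2_eq_square flip: exp_add)
  have "?s\<^sup>2 \<le> exp (2 * a * \<bar>Re z\<bar>)"
    unfolding e by (intro power_mono norm_sinhc_le) auto
  moreover have "(norm (of_real a * z) * ?s)\<^sup>2 \<le> exp (2 * a * \<bar>Re z\<bar>)"
    unfolding e by (intro power_mono norm_mult_sinhc_le) auto
  ultimately have "?s\<^sup>2 + (norm z)\<^sup>2 * ?s\<^sup>2 \<le> exp (2 * a * \<bar>Re z\<bar>) + exp (2 * a * \<bar>Re z\<bar>) / a\<^sup>2"
    using a by (intro add_mono) (auto simp: norm_mult power_mult_distrib field_simps)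
  then show ?thesis by (simp add: algebra_simps)
qed

text \<open>With $s = \sin^2 x \le x^2$, the claim is
  $s (1 - s) (1 + x^2) - x^2 = (s - x^2)(1 - s) - s^2 x^2 \le 0$.\<close>

lemma one_plus_square_sinhc_axis_le:
  fixes x :: real
  shows "(1 + x\<^sup>2) * (norm (sinhc (2 * (\<i> * of_real x))))\<^sup>2 \<le> 1"
proof (cases "x = 0")
  case False
  have "sinh (2 * (\<i> * of_real x)) = (cis (2 * x) - cis (- (2 * x))) / 2"
    unfolding sinh_field_def cis_conv_exp by (simp add: mult_ac)
  also have "\<dots> = \<i> * of_real (sin (2 * x))" by (simp add: complex_eq_iff)
  finally have n: "norm (sinh (2 * (\<i> * of_real x))) = \<bar>sin (2 * x)\<bar>"
    by (simp only: norm_mult norm_ii norm_of_real mult_1)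
  define s where "s = (sin x)\<^sup>2"
  have s: "0 \<le> s" "s \<le> 1" "s \<le> x\<^sup>2"
    unfolding s_def using abs_sin_x_le_abs_x[of x] abs_le_square_iff[of "sin x" x]
    by (auto simp: abs_square_le_1)
  have "(s - x\<^sup>2) * (1 - s) - s\<^sup>2 * x\<^sup>2 \<le> 0"
    using s mult_nonpos_nonneg[of "s - x\<^sup>2" "1 - s"] by (smt (verit) mult_nonneg_nonneg zero_le_power2)
  then have *: "s * (1 - s) * (1 + x\<^sup>2) \<le> x\<^sup>2" by (simp add: algebra_simps power2_eq_square)
  have "(sin (2 * x))\<^sup>2 = 4 * (s * (1 - s))"
    by (simp add: s_def sin_double power_mult_distrib cos_squared_eq)
  then have "(1 + x\<^sup>2) * (norm (sinhc (2 * (\<i> * of_real x))))\<^sup>2 = (s * (1 - s) * (1 + x\<^sup>2)) / x\<^sup>2"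
    using False by (simp add: sinhc_def n norm_divide norm_mult power_divide power_mult_distrib)
  also have "\<dots> \<le> 1" using * False by (simp add: divide_le_eq)
  finally show ?thesis .
qed (simp add: sinhc_def)

section \<open>Division of entire functions\<close>

lemma higher_deriv_mult_eq_0:
  fixes f g :: "complex \<Rightarrow> complex"
  assumes "f holomorphic_on S" "g holomorphic_on S" "open S" "a \<in> S"
    and "\<And>i. i < m \<Longrightarrow> (deriv ^^ i) g a = 0" and "j < m"
  shows "(deriv ^^ j) (\<lambda>z. f z * g z) a = 0"
  unfolding higher_deriv_mult[OF assms(1-4)] using assms(5,6) by (intro sum.neutral) auto

lemma higher_deriv_power_at_0:
  "(deriv ^^ i) (\<lambda>w. (w - a) ^ n) a = (if i = n then fact n else 0 :: complex)"
proof -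
  have "(0::complex) ^ (n - i) * pochhammer (of_nat (Suc n - i)) i = (if i = n then fact n else 0)"
  proof (cases i n rule: linorder_cases)
    case greater
    then obtain d where "Suc n - i = 0" "i = Suc d" by (cases i) auto
    then show ?thesis using greater by (simp add: pochhammer_0_left)
  qed (auto simp: pochhammer_fact[symmetric])
  then show ?thesis by (simp add: higher_deriv_power mult.commute)
qed

text \<open>If f = (z - a)^m h, Leibniz's rule at \<open>a\<close> leaves only the term with all m
  derivatives on the power, so the m-th derivative of f is m! h(a); its vanishing frees one more
  factor.\<close>

lemma entire_factor:
  assumes "f holomorphic_on UNIV" "\<And>j. j < m \<Longrightarrow> (deriv ^^ j) f a = 0"
  shows "\<exists>h. h holomorphic_on UNIV \<and> (\<forall>z. f z = (z - a) ^ m * h z)"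
  using assms(2)
proof (induction m)
  case 0
  then show ?case using assms(1) by auto
next
  case (Suc m)
  then obtain h where h: "h holomorphic_on UNIV" and fh: "\<And>z. f z = (z - a) ^ m * h z" by force
  have "(deriv ^^ m) (\<lambda>z. (z - a) ^ m * h z) a =
      (\<Sum>i = 0..m. of_nat (m choose i) * (deriv ^^ i) (\<lambda>z. (z - a) ^ m) a * (deriv ^^ (m - i)) h a)"
    by (rule higher_deriv_mult[of _ UNIV]) (use h in \<open>auto intro!: holomorphic_intros\<close>)
  also have "\<dots> = (\<Sum>i = 0..m. if i = m then fact m * h a else 0)"
    by (intro sum.cong) (auto simp: higher_deriv_power_at_0)
  also have "\<dots> = fact m * h a" by (simp add: sum.delta)
  also have "(\<lambda>z. (z - a) ^ m * h z) = f" using fh by auto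
  finally have "h a = 0" using Suc.prems[of m] by simp
  define h' where "h' = (\<lambda>z. if z = a then deriv h a else (h z - h a) / (z - a))"
  have "h' holomorphic_on UNIV" unfolding h'_def by (rule pole_lemma[OF h]) auto
  moreover have "f z = (z - a) ^ Suc m * h' z" for z
    using fh[of z] \<open>h a = 0\<close> by (simp add: h'_def)
  ultimately show ?case by blast
qed

text \<open>The quotient is g / (z - b)^k away from \<open>b\<close> and h / p near
  \<open>b\<close>, and the two agree on the overlap. This lets zeros at distinct points be divided
  out one point at a time.\<close>

lemma entire_factor_coprime:
  assumes "p holomorphic_on UNIV" "g holomorphic_on UNIV" "h holomorphic_on UNIV"
    and eq: "\<And>z. p z * g z = (z - b) ^ k * h z" and "p b \<noteq> 0"
  shows "\<exists>q. q holomorphic_on UNIV \<and> (\<forall>z. g z = (z - b) ^ k * q z)"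
proof -
  define q where "q z = (if z = b then h b / p b else g z / (z - b) ^ k)" for z
  define A where "A = {z. p z \<noteq> 0}"
  have "open A"
    unfolding A_def using assms(1) by (intro open_Collect_neq) (auto intro: holomorphic_on_imp_continuous_on)
  have q1: "q holomorphic_on UNIV - {b}"
  proof (rule holomorphic_transform)
    show "(\<lambda>z. g z / (z - b) ^ k) holomorphic_on UNIV - {b}"
      using assms(2) holomorphic_on_subset by (auto intro!: holomorphic_intros)
  qed (auto simp: q_def)
  have q2: "q holomorphic_on A"
  proof (rule holomorphic_transform)
    show "(\<lambda>z. h z / p z) holomorphic_on A"
      using assms(1,3) holomorphic_on_subset by (auto intro!: holomorphic_intros simp: A_def)
    show "h z / p z = q z" if "z \<in> A" for z
      using eq[of z] that by (auto simp: q_def A_def field_simps)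
  qed
  have "q holomorphic_on (UNIV - {b}) \<union> A"
    using q1 q2 \<open>open A\<close> by (intro holomorphic_on_Un) auto
  moreover have "(UNIV - {b}) \<union> A = UNIV" using assms(5) by (auto simp: A_def)
  moreover have "g z = (z - b) ^ k * q z" for z
    using eq[of b] assms(5) by (cases "z = b"; cases k) (auto simp: q_def field_simps)
  ultimately show ?thesis by auto
qed

lemma entire_divide_prod:
  fixes lam :: "'i \<Rightarrow> complex"
  assumes "finite S" "inj_on lam S" "f holomorphic_on UNIV" "\<And>m. m \<in> S \<Longrightarrow> lam m \<noteq> 0"
    and "\<And>m j. m \<in> S \<Longrightarrow> j < mu m \<Longrightarrow> (deriv ^^ j) f (lam m) = 0"
  shows "\<exists>g. g holomorphic_on UNIV \<and> (\<forall>z. f z = (\<Prod>m\<in>S. (1 - z / lam m) ^ mu m) * g z)"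
  using assms
proof (induction S rule: finite_induct)
  case empty
  then show ?case by auto
next
  case (insert a S)
  obtain g where g: "g holomorphic_on UNIV" and fg: "\<And>z. f z = (\<Prod>m\<in>S. (1 - z / lam m) ^ mu m) * g z"
    using insert.IH insert.prems by (auto simp: inj_on_insert)
  obtain h where h: "h holomorphic_on UNIV" and fh: "\<And>z. f z = (z - lam a) ^ mu a * h z"
    using entire_factor[of f "mu a" "lam a"] insert.prems by blast
  have ne: "1 - lam a / lam m \<noteq> 0" if "m \<in> S" for m
    using that insert.prems(1,3)[of ] insert.hyps by (auto simp: inj_on_def divide_eq_1_iff)
  have nz: "(\<Prod>m\<in>S. (1 - lam a / lam m) ^ mu m) \<noteq> 0"
    unfolding prod_zero_iff[OF insert.hyps(1)] using ne by (metis power_eq_0_iff)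
  have "(\<lambda>z. \<Prod>m\<in>S. (1 - z / lam m) ^ mu m) holomorphic_on UNIV"
    using insert.prems(3) by (intro holomorphic_intros) auto
  from entire_factor_coprime[OF this g h _ nz] fg fh
  obtain q where q: "q holomorphic_on UNIV" and gq: "\<And>z. g z = (z - lam a) ^ mu a * q z" by metis
  have la: "lam a \<noteq> 0" using insert.prems by blast
  have "z - lam a = - lam a * (1 - z / lam a)" for z using la by (simp add: field_simps)
  then have "(z - lam a) ^ mu a = (- lam a) ^ mu a * (1 - z / lam a) ^ mu a" for z
    by (metis power_mult_distrib)
  then have "f z = (\<Prod>m\<in>insert a S. (1 - z / lam m) ^ mu m) * ((- lam a) ^ mu a * q z)" for z
    using fg[of z] gq[of z] insert.hyps by (simp add: mult_ac)
  moreover have "(\<lambda>z. (- lam a) ^ mu a * q z) holomorphic_on UNIV" using q by (intro holomorphic_intros)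
  ultimately show ?case by blast
qed

text \<open>The zeros inside the circle are reflected in it, which changes no modulus on the circle and
  makes the divisor bounded below on the half-size disc.\<close>

lemma entire_quotient_bound:
  fixes lam :: "'i \<Rightarrow> complex" and mu :: "'i \<Rightarrow> nat"
  assumes S: "finite S" and nz: "\<And>m. m \<in> S \<Longrightarrow> lam m \<noteq> 0" and g: "g holomorphic_on UNIV" and R: "R > 0"
    and B: "\<And>z. norm z = R \<Longrightarrow> norm ((\<Prod>m\<in>S. (1 - z / lam m) ^ mu m) * g z) \<le> B"
    and z: "norm z \<le> R / 2"
  shows "norm (g z) \<le> B * exp (\<Sum>m\<in>S. real (mu m) * min 1 (R / norm (lam m)))"
proof -
  \<comment> \<open>The first branch is the reflected factor, with zero at R^2 / cnj(lambda_m);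
    points outside the circle keep their factor.\<close>
  define q where "q m w = (if norm (lam m) \<le> R then (of_real (R\<^sup>2) - cnj (lam m) * w) / (of_real R * lam m)
      else 1 - w / lam m)" for m w
  have qhol: "q m holomorphic_on UNIV" if "m \<in> S" for m
    using nz[OF that] R unfolding q_def[abs_def] by (cases "norm (lam m) \<le> R") (auto intro!: holomorphic_intros)
  define F where "F w = (\<Prod>m\<in>S. q m w ^ mu m) * g w" for w
  have Fhol: "F holomorphic_on UNIV"
    unfolding F_def[abs_def] using qhol g by (intro holomorphic_intros) auto
  have qR: "norm (q m w) = norm (1 - w / lam m)" if "norm w = R" "m \<in> S" for m w
  proof (cases "norm (lam m) \<le> R")
    case True
    have "of_real (R\<^sup>2) = w * cnj w" using that(1) complex_norm_square[of w] by simp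
    then have "of_real (R\<^sup>2) - cnj (lam m) * w = w * cnj (w - lam m)" by (simp add: algebra_simps)
    then have "norm (of_real (R\<^sup>2) - cnj (lam m) * w) = R * norm (w - lam m)"
      using that(1) by (simp only: norm_mult complex_mod_cnj)
    then have "norm (q m w) = norm (w - lam m) / norm (lam m)"
      using True R by (simp add: q_def norm_divide norm_mult)
    also have "\<dots> = norm ((lam m - w) / lam m)" by (simp add: norm_divide norm_minus_commute)
    also have "(lam m - w) / lam m = 1 - w / lam m" using nz[OF that(2)] by (simp add: diff_divide_distrib)
    finally show ?thesis .
  qed (simp add: q_def)
  have "norm (F z) \<le> B"
  proof (rule maximum_modulus_frontier[of F "ball 0 R"])
    show "F holomorphic_on interior (ball 0 R)" using Fhol holomorphic_on_subset by blast
    show "continuous_on (closure (ball 0 R)) F"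
      using Fhol holomorphic_on_imp_continuous_on continuous_on_subset by blast
    show "norm (F w) \<le> B" if "w \<in> frontier (ball 0 R)" for w
    proof -
      have w: "norm w = R" using that R by (simp add: frontier_ball)
      have "norm (F w) = norm ((\<Prod>m\<in>S. (1 - w / lam m) ^ mu m) * g w)"
        unfolding F_def norm_mult prod_norm[symmetric] norm_power using qR[OF w]
        by (intro arg_cong2[where f="(*)"] prod.cong refl) auto
      then show ?thesis using B[OF w] by simp
    qed
    show "z \<in> ball 0 R" using z R by simp
  qed auto
  \<comment> \<open>On the half-size disc a reflected factor is at least (R^2/2)/R^2 = 1/2 >=
    exp(-1); an outer factor is at least 1 - x with x <= R/(2|lambda_m|), hence at least
    exp(-2x).\<close>
  have ql: "exp (- min 1 (R / norm (lam m))) \<le> norm (q m z)" if m: "m \<in> S" for m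
  proof (cases "norm (lam m) \<le> R")
    case True
    have lp: "norm (lam m) > 0" using nz[OF m] by simp
    have "norm (cnj (lam m) * z) \<le> R * (R / 2)"
      unfolding norm_mult using True z R by (intro mult_mono) auto
    then have "norm (of_real (R\<^sup>2) - cnj (lam m) * z) \<ge> R * R / 2"
      using norm_triangle_ineq2[of "of_real (R\<^sup>2)" "cnj (lam m) * z"] R by (simp add: power2_eq_square norm_mult)
    moreover have "R * norm (lam m) \<le> R * R" using True R by simp
    moreover have "0 < R * norm (lam m)" using R lp by simp
    ultimately have "(R * R / 2) / (R * R) \<le> norm (of_real (R\<^sup>2) - cnj (lam m) * z) / (R * norm (lam m))"
      by (intro frac_le) (simp_all del: of_real_power)
    then have "1/2 \<le> norm (q m z)" using R True by (simp add: q_def norm_divide norm_mult)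
    moreover have "exp (-1) \<le> (1/2::real)"
      using exp_ge_add_one_self[of "1::real"] by (simp add: exp_minus field_simps)
    moreover have "min 1 (R / norm (lam m)) = 1" using True lp by (simp add: field_simps)
    ultimately show ?thesis by simp
  next
    case False
    then have lp: "norm (lam m) > R" by simp
    let ?x = "norm z / norm (lam m)"
    have x: "?x \<le> R / norm (lam m) / 2" using divide_right_mono[OF z, of "norm (lam m)"] by simp
    have R1: "R / norm (lam m) \<le> 1" using lp R by (auto simp: divide_le_eq_1)
    have x0: "0 \<le> ?x" by simp
    have "exp (- min 1 (R / norm (lam m))) \<le> exp (- (2 * ?x))" using x R1 by simp
    also have "\<dots> \<le> 1 - ?x" using order_trans[OF x, of "1/2"] divide_right_mono[OF R1, of 2] by (intro exp_minus_double_le) auto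
    also have "\<dots> \<le> norm (1 - z / lam m)" using norm_triangle_ineq2[of 1 "z / lam m"] by (simp add: norm_divide)
    finally show ?thesis using False by (simp add: q_def)
  qed
  let ?E = "\<Sum>m\<in>S. real (mu m) * min 1 (R / norm (lam m))"
  have "exp (- ?E) = (\<Prod>m\<in>S. exp (- min 1 (R / norm (lam m))) ^ mu m)"
    using S by (simp add: exp_sum exp_of_nat_mult sum_negf[symmetric] flip: exp_of_nat_mult)
  also have "\<dots> \<le> (\<Prod>m\<in>S. norm (q m z) ^ mu m)"
    using ql by (intro prod_mono conjI power_mono) auto
  also have "\<dots> = norm (\<Prod>m\<in>S. q m z ^ mu m)" by (simp add: prod_norm[symmetric] norm_power)
  finally have "exp (- ?E) * norm (g z) \<le> norm (F z)"
    unfolding F_def norm_mult by (intro mult_right_mono) auto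
  then have "exp (- ?E) * norm (g z) \<le> B" using \<open>norm (F z) \<le> B\<close> by linarith
  then show ?thesis by (simp add: exp_minus field_simps)
qed

section \<open>The multiplier\<close>

text \<open>Each squared factor decays quadratically on the imaginary axis and so can meet the pair
  (1 - z/lambda_m)(1 + z/lambda_m); the extra leading factor supplies the integrable weight 1/(1 +
  y^2).\<close>

definition mult_ker :: "real \<Rightarrow> (nat \<Rightarrow> real) \<Rightarrow> (nat \<Rightarrow> nat) \<Rightarrow> nat \<Rightarrow> complex \<Rightarrow> complex" where
  "mult_ker a c mu N z = sinhc (of_real a * z) ^ 2 * (\<Prod>m<N. (sinhc (of_real (c m) * z) ^ 2) ^ mu m)"

lemma holomorphic_mult_ker: "mult_ker a c mu N holomorphic_on S"
  unfolding mult_ker_def[abs_def] by (intro holomorphic_intros)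

lemma norm_mult_ker:
  "norm (mult_ker a c mu N z) = (norm (sinhc (of_real a * z)))\<^sup>2 * (\<Prod>m<N. ((norm (sinhc (of_real (c m) * z)))\<^sup>2) ^ mu m)"
  by (simp add: mult_ker_def norm_mult norm_power prod_norm[symmetric])

text \<open>Tail indices get the rate \<open>2 / r m\<close>, for which each factor beats 1 +
  (y/r_m)^2 with constant 1; the small total type is ensured by the small tail of the series. The
  finitely many head indices get the small rate \<open>a / r m\<close> and cost a constant each,
  whence a \<open>C0\<close> independent of \<open>N\<close>.\<close>

lemma multiplier_exists:
  fixes r :: "nat \<Rightarrow> real" and mu :: "nat \<Rightarrow> nat"
  assumes sm: "summable (\<lambda>n. real (mu n) / r n)" and r: "\<And>n. r n > 0" and \<delta>: "\<delta> > 0"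
  shows "\<exists>a c C0. a > 0 \<and> (\<forall>m. c m > 0) \<and> C0 \<ge> 0 \<and>
    (\<forall>N. 2 * a + (\<Sum>m<N. 2 * real (mu m) * c m) \<le> \<delta>) \<and>
    (\<forall>N y. norm (mult_ker a c mu N (\<i> * of_real y)) * (\<Prod>m<N. (1 + (y / r m)\<^sup>2) ^ mu m) \<le> C0 / (1 + y\<^sup>2))"
proof -
  have "\<delta> / 8 > 0" using \<delta> by simp
  then obtain m0 where m0: "\<And>N. norm (\<Sum>m\<in>{m0..<N}. real (mu m) / r m) < \<delta> / 8"
    using sm unfolding summable_Cauchy by blast
  define \<sigma> where "\<sigma> = (\<Sum>m<m0. real (mu m) / r m)"
  have \<sigma>: "\<sigma> \<ge> 0" unfolding \<sigma>_def using r by (intro sum_nonneg) (simp add: less_imp_le)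
  \<comment> \<open>Half of \<open>\<delta>\<close> goes to the leading factor and the head, 2a(1 +
    \<open>\<sigma>\<close>) = \<open>\<delta>\<close>/2; the tail uses less than 4 times
    \<open>\<delta>\<close>/8.\<close>
  define a where "a = \<delta> / (4 * (1 + \<sigma>))"
  have a: "a > 0" using \<delta> \<sigma> by (simp add: a_def)
  have "1 + \<sigma> \<noteq> 0" using \<sigma> by linarith
  then have "a * (1 + \<sigma>) = \<delta> / 4" unfolding a_def by (metis (no_types) divide_divide_eq_left nonzero_eq_divide_eq)
  then have a2: "2 * a + 2 * a * \<sigma> = \<delta> / 2" by (simp add: algebra_simps)
  define c where "c m = (if m < m0 then a else 2) / r m" for m
  have c: "c m > 0" for m using a r[of m] by (simp add: c_def)
  define L where "L = 1 + 1 / a\<^sup>2"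
  have L: "L \<ge> 1" by (simp add: L_def)
  define C0 where "C0 = L * L ^ (\<Sum>m<m0. mu m)"
  show ?thesis
  proof (rule exI[of _ a], rule exI[of _ c], rule exI[of _ C0], intro conjI allI)
    show "a > 0" by (rule a)
    show "c m > 0" for m by (rule c)
    show "C0 \<ge> 0" using L by (simp add: C0_def)
    fix N
    have "(\<Sum>m<N. 2 * real (mu m) * c m) \<le> (\<Sum>m\<in>{..<m0} \<union> {m0..<N}. 2 * real (mu m) * c m)"
      using c by (intro sum_mono2) (auto intro!: mult_nonneg_nonneg simp: less_imp_le)
    also have "\<dots> = (\<Sum>m<m0. 2 * real (mu m) * c m) + (\<Sum>m\<in>{m0..<N}. 2 * real (mu m) * c m)"
      by (intro sum.union_disjoint) auto
    also have "(\<Sum>m<m0. 2 * real (mu m) * c m) = 2 * a * \<sigma>"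
      by (simp add: c_def \<sigma>_def sum_distrib_left mult_ac)
    also have "(\<Sum>m\<in>{m0..<N}. 2 * real (mu m) * c m) = 4 * (\<Sum>m\<in>{m0..<N}. real (mu m) / r m)"
      unfolding sum_distrib_left by (intro sum.cong) (auto simp: c_def)
    finally show "2 * a + (\<Sum>m<N. 2 * real (mu m) * c m) \<le> \<delta>"
      using a2 m0[of N] by auto
  next
    fix N and y :: real
    have f: "(norm (sinhc (of_real (c m) * (\<i> * of_real y))))\<^sup>2 * (1 + (y / r m)\<^sup>2) \<le> (if m < m0 then L else 1)" for m
    proof (cases "m < m0")
      case True
      have "of_real (c m) * (\<i> * of_real y) = of_real a * (\<i> * complex_of_real (y / r m))"
        using True by (simp add: c_def)
      then show ?thesis
        using one_plus_square_sinhc_le[OF a, of "\<i> * complex_of_real (y / r m)"] True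
        by (simp add: L_def norm_mult mult.commute norm_divide power_divide)
    next
      case False
      have "of_real (c m) * (\<i> * of_real y) = 2 * (\<i> * complex_of_real (y / r m))"
        using False by (simp add: c_def)
      then show ?thesis using one_plus_square_sinhc_axis_le[of "y / r m"] False
        by (simp add: mult.commute)
    qed
    have "(\<Prod>m<N. ((norm (sinhc (of_real (c m) * (\<i> * of_real y))))\<^sup>2) ^ mu m) * (\<Prod>m<N. (1 + (y / r m)\<^sup>2) ^ mu m)
       = (\<Prod>m<N. ((norm (sinhc (of_real (c m) * (\<i> * of_real y))))\<^sup>2 * (1 + (y / r m)\<^sup>2)) ^ mu m)"
      by (simp only: prod.distrib[symmetric] power_mult_distrib[symmetric])
    also have "\<dots> \<le> (\<Prod>m<N. (if m < m0 then L else 1) ^ mu m)"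
      using f by (intro prod_mono conjI power_mono) auto
    also have "\<dots> = (\<Prod>m<N. L ^ (if m < m0 then mu m else 0))" by (intro prod.cong) auto
    also have "\<dots> = L ^ (\<Sum>m<N. if m < m0 then mu m else 0)" by (rule power_sum[symmetric])
    also have "\<dots> \<le> L ^ (\<Sum>m<m0. mu m)"
    proof (rule power_increasing[OF _ L])
      have "(\<Sum>m<N. if m < m0 then mu m else 0) = (\<Sum>m\<in>{..<N} \<inter> {m. m < m0}. mu m)"
        by (subst sum.inter_restrict) auto
      also have "\<dots> \<le> (\<Sum>m<m0. mu m)" by (intro sum_mono2) auto
      finally show "(\<Sum>m<N. if m < m0 then mu m else 0) \<le> (\<Sum>m<m0. mu m)" .
    qed
    finally have 1: "(\<Prod>m<N. ((norm (sinhc (of_real (c m) * (\<i> * of_real y))))\<^sup>2) ^ mu m) * (\<Prod>m<N. (1 + (y / r m)\<^sup>2) ^ mu m) \<le> L ^ (\<Sum>m<m0. mu m)" .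
    have "(1 + y\<^sup>2) * (norm (sinhc (of_real a * (\<i> * of_real y))))\<^sup>2 \<le> L"
      using one_plus_square_sinhc_le[OF a, of "\<i> * of_real y"] by (simp add: L_def norm_mult)
    then have 2: "(norm (sinhc (of_real a * (\<i> * of_real y))))\<^sup>2 \<le> L / (1 + y\<^sup>2)"
      by (simp add: field_simps add_pos_nonneg)
    have "norm (mult_ker a c mu N (\<i> * of_real y)) * (\<Prod>m<N. (1 + (y / r m)\<^sup>2) ^ mu m) \<le>
       L / (1 + y\<^sup>2) * L ^ (\<Sum>m<m0. mu m)"
      unfolding norm_mult_ker mult.assoc using L
      by (intro mult_mono 1 2) (auto intro!: divide_nonneg_nonneg mult_nonneg_nonneg prod_nonneg)
    then show "norm (mult_ker a c mu N (\<i> * of_real y)) * (\<Prod>m<N. (1 + (y / r m)\<^sup>2) ^ mu m) \<le> C0 / (1 + y\<^sup>2)"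
      by (simp add: C0_def)
  qed
qed

text \<open>Here the constant is a product over all m < \<open>N\<close> and may grow with
  \<open>N\<close>; it is destined for the constant \<open>C'\<close> of
  \<open>laplace_functional_bound\<close>.\<close>

lemma mult_ker_growth:
  assumes a: "a > 0" and c: "\<And>m. c m > 0" and r: "\<And>m. r m > 0"
    and \<delta>: "2 * a + (\<Sum>m<N. 2 * real (mu m) * c m) \<le> \<delta>"
  obtains C' where "C' \<ge> 0" "\<And>z. norm (mult_ker a c mu N z) * (\<Prod>m<N. ((1 + norm z / r m)\<^sup>2) ^ mu m) \<le>
     C' * exp (\<delta> * \<bar>Re z\<bar>) / (1 + (norm z)\<^sup>2)"
proof -
  define L where "L m = 1 + 1 / (c m * r m)" for m
  define C' where "C' = (1 + 1 / a\<^sup>2) * (\<Prod>m<N. ((L m)\<^sup>2) ^ mu m)"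
  show thesis
  proof (rule that[of C'])
    show "C' \<ge> 0" unfolding C'_def by (intro mult_nonneg_nonneg prod_nonneg) auto
    fix z
    let ?x = "\<bar>Re z\<bar>"
    have f: "norm (sinhc (of_real (c m) * z)) * (1 + norm z / r m) \<le> L m * exp (c m * ?x)" for m
    proof -
      have "norm (sinhc (of_real (c m) * z)) \<le> exp (c m * ?x)"
        using norm_sinhc_le[of "of_real (c m) * z"] c[of m] by (simp add: abs_mult)
      moreover have "c m * norm z * norm (sinhc (of_real (c m) * z)) \<le> exp (c m * ?x)"
        using norm_mult_sinhc_le[of "of_real (c m) * z"] c[of m] by (simp add: abs_mult norm_mult)
      then have "(c m * norm z * norm (sinhc (of_real (c m) * z))) / (c m * r m) \<le> exp (c m * ?x) / (c m * r m)"
        using c r by (intro divide_right_mono) (auto simp: less_imp_le)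
      then have "norm (sinhc (of_real (c m) * z)) * (norm z / r m) \<le> exp (c m * ?x) / (c m * r m)"
        using c[of m] r[of m] by (simp add: mult_ac)
      ultimately show ?thesis by (simp add: L_def algebra_simps)
    qed
    have "(\<Prod>m<N. ((norm (sinhc (of_real (c m) * z)))\<^sup>2) ^ mu m) * (\<Prod>m<N. ((1 + norm z / r m)\<^sup>2) ^ mu m)
       = (\<Prod>m<N. ((norm (sinhc (of_real (c m) * z)) * (1 + norm z / r m))\<^sup>2) ^ mu m)"
      by (simp only: prod.distrib[symmetric] power_mult_distrib[symmetric])
    also have "\<dots> \<le> (\<Prod>m<N. ((L m * exp (c m * ?x))\<^sup>2) ^ mu m)"
      using f r by (intro prod_mono conjI power_mono) (auto intro!: mult_nonneg_nonneg add_nonneg_nonneg simp: less_imp_le)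
    also have "\<dots> = (\<Prod>m<N. ((L m)\<^sup>2) ^ mu m) * (\<Prod>m<N. ((exp (c m * ?x))\<^sup>2) ^ mu m)"
      by (simp only: prod.distrib[symmetric] power_mult_distrib[symmetric])
    also have "(\<Prod>m<N. ((exp (c m * ?x))\<^sup>2) ^ mu m) = exp ((\<Sum>m<N. 2 * real (mu m) * c m) * ?x)"
      unfolding sum_distrib_right by (simp add: exp_sum flip: exp_of_nat_mult power_mult) (simp add: mult_ac)
    finally have 1: "(\<Prod>m<N. ((norm (sinhc (of_real (c m) * z)))\<^sup>2) ^ mu m) * (\<Prod>m<N. ((1 + norm z / r m)\<^sup>2) ^ mu m)
       \<le> (\<Prod>m<N. ((L m)\<^sup>2) ^ mu m) * exp ((\<Sum>m<N. 2 * real (mu m) * c m) * ?x)" .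
    have 2: "(norm (sinhc (of_real a * z)))\<^sup>2 \<le> (1 + 1 / a\<^sup>2) * exp (2 * a * ?x) / (1 + (norm z)\<^sup>2)"
      using one_plus_square_sinhc_le[OF a, of z] by (simp add: field_simps add_pos_nonneg)
    have "norm (mult_ker a c mu N z) * (\<Prod>m<N. ((1 + norm z / r m)\<^sup>2) ^ mu m) \<le>
       (1 + 1 / a\<^sup>2) * exp (2 * a * ?x) / (1 + (norm z)\<^sup>2) * ((\<Prod>m<N. ((L m)\<^sup>2) ^ mu m) * exp ((\<Sum>m<N. 2 * real (mu m) * c m) * ?x))"
      unfolding norm_mult_ker mult.assoc[of "(norm (sinhc (of_real a * z)))\<^sup>2"]
      by (intro mult_mono 1 2) (auto intro!: divide_nonneg_nonneg mult_nonneg_nonneg prod_nonneg add_nonneg_nonneg)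
    also have "\<dots> = C' * exp ((2 * a + (\<Sum>m<N. 2 * real (mu m) * c m)) * ?x) / (1 + (norm z)\<^sup>2)"
    proof -
      have "u * e / d * (p * e') = u * p * (e * e') / d" for u e d p e' :: real by simp
      then show ?thesis unfolding C'_def distrib_right[of "2 * a"] exp_add .
    qed
    also have "\<dots> \<le> C' * exp (\<delta> * ?x) / (1 + (norm z)\<^sup>2)"
      using \<delta> \<open>C' \<ge> 0\<close> by (intro divide_right_mono mult_left_mono) (auto intro!: mult_right_mono add_nonneg_nonneg)
    finally show "norm (mult_ker a c mu N z) * (\<Prod>m<N. ((1 + norm z / r m)\<^sup>2) ^ mu m) \<le>
       C' * exp (\<delta> * \<bar>Re z\<bar>) / (1 + (norm z)\<^sup>2)" .
  qed
qed

text \<open>The exponents of the factorwise bounds add up to the total type, which is at most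
  \<open>\<delta>\<close>; so the number of factors leaves no trace.\<close>

lemma mult_ker_lower:
  assumes a: "a > 0" and c: "\<And>m. c m > 0"
    and \<delta>: "2 * a + (\<Sum>m<N. 2 * real (mu m) * c m) \<le> \<delta>"
    and \<kappa>: "0 < \<kappa>" "\<kappa> \<le> 1" and z: "\<kappa> * norm z \<le> Re z"
  shows "exp (- (2 * (1 - ln \<kappa>) * \<delta> * norm z)) \<le> norm (mult_ker a c mu N z)"
proof -
  define A where "A = 2 * (1 - ln \<kappa>)"
  have "ln \<kappa> \<le> 0" using \<kappa> by simp
  then have A: "A \<ge> 0" by (simp add: A_def)
  have s: "exp (- (A * t * norm z)) \<le> norm (sinhc (of_real t * z))" if t: "t > 0" for t
  proof -
    have "\<kappa> * norm (of_real t * z) \<le> Re (of_real t * z)"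
      using mult_left_mono[OF z, of t] t by (simp add: norm_mult mult_ac)
    from norm_sinhc_ge[OF \<kappa> this] show ?thesis using t by (simp add: A_def norm_mult mult_ac)
  qed
  have "A * ((2 * a + (\<Sum>m<N. 2 * real (mu m) * c m)) * norm z) \<le> A * (\<delta> * norm z)"
    using \<delta> A by (intro mult_left_mono mult_right_mono) auto
  then have "exp (- (A * \<delta> * norm z)) \<le> exp (- (A * (2 * a + (\<Sum>m<N. 2 * real (mu m) * c m)) * norm z))"
    by (simp add: mult.assoc)
  also have "- (A * (2 * a + (\<Sum>m<N. 2 * real (mu m) * c m)) * norm z) =
      2 * (- (A * a * norm z)) + (\<Sum>m<N. real (mu m) * (2 * (- (A * c m * norm z))))"
    by (simp add: sum_distrib_left sum_distrib_right algebra_simps sum_negf)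
  also have "exp \<dots> = (exp (- (A * a * norm z)))\<^sup>2 * (\<Prod>m<N. ((exp (- (A * c m * norm z)))\<^sup>2) ^ mu m)"
    by (simp only: exp_add exp_sum[OF finite_lessThan] exp_of_nat_mult exp_double)
  also have "\<dots> \<le> norm (mult_ker a c mu N z)"
    unfolding norm_mult_ker
    by (intro mult_mono prod_mono power_mono conjI s a c) (auto intro!: prod_nonneg)
  finally show ?thesis by (simp add: A_def)
qed

text \<open>For Re z >= 0 adding z to lambda_m cannot lower the real part, so |lambda_m + z| >= Re
  lambda_m >= \<open>\<kappa>\<close> |lambda_m|.\<close>

lemma prod_one_plus_lower:
  fixes lam :: "nat \<Rightarrow> complex"
  assumes \<kappa>: "0 < \<kappa>" "\<kappa> \<le> 1" and lam: "\<And>m. lam m \<noteq> 0" "\<And>m. \<kappa> * norm (lam m) \<le> Re (lam m)" and z: "Re z \<ge> 0"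
  shows "exp (- (2 * (1 - ln \<kappa>) * (\<Sum>m<N. real (mu m) * min 1 (norm z / norm (lam m)))))
     \<le> norm (\<Prod>m<N. (1 + z / lam m) ^ mu m)"
proof -
  define A where "A = 2 * (1 - ln \<kappa>)"
  have f: "exp (- (A * min 1 (norm z / norm (lam m)))) \<le> norm (1 + z / lam m)" for m
    unfolding A_def
  proof (rule exp_lower_boundI[OF \<kappa>])
    have lp: "norm (lam m) > 0" using lam(1)[of m] by simp
    have "\<kappa> * norm (lam m) \<le> Re (lam m + z)" using lam(2)[of m] z by simp
    also have "\<dots> \<le> norm (lam m + z)" by (rule complex_Re_le_cmod)
    finally have "\<kappa> \<le> norm ((lam m + z) / lam m)" using lp by (simp add: norm_divide pos_le_divide_eq)
    then show "\<kappa> \<le> norm (1 + z / lam m)" using lam(1)[of m] by (simp add: add_divide_distrib)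
    show "1 - norm z / norm (lam m) \<le> norm (1 + z / lam m)"
      using norm_diff_ineq[of 1 "z / lam m"] by (simp add: norm_divide)
  qed auto
  have "exp (- (A * (\<Sum>m<N. real (mu m) * min 1 (norm z / norm (lam m))))) =
     (\<Prod>m<N. exp (- (A * min 1 (norm z / norm (lam m)))) ^ mu m)"
    by (simp add: sum_distrib_left exp_sum mult_ac flip: sum_negf exp_of_nat_mult)
  also have "\<dots> \<le> (\<Prod>m<N. norm (1 + z / lam m) ^ mu m)"
    using f by (intro prod_mono conjI power_mono) auto
  also have "\<dots> = norm (\<Prod>m<N. (1 + z / lam m) ^ mu m)" by (simp add: prod_norm[symmetric] norm_power)
  finally show ?thesis by (simp only: A_def)
qed

section \<open>Interpolating kernels\<close>

lemma higher_deriv_taylor_poly: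
  "(deriv ^^ i) (\<lambda>z. \<Sum>j<n. c j * (z - a) ^ j) a = (if i < n then fact i * c i else 0 :: complex)"
proof (induction n)
  case (Suc n)
  have "(deriv ^^ i) (\<lambda>z. (\<Sum>j<n. c j * (z - a) ^ j) + c n * (z - a) ^ n) a =
      (deriv ^^ i) (\<lambda>z. \<Sum>j<n. c j * (z - a) ^ j) a + (deriv ^^ i) (\<lambda>z. c n * (z - a) ^ n) a"
    by (rule higher_deriv_add[of _ UNIV]) (auto intro!: holomorphic_intros)
  also have "(deriv ^^ i) (\<lambda>z. c n * (z - a) ^ n) a = c n * (deriv ^^ i) (\<lambda>z. (z - a) ^ n) a"
    by (rule higher_deriv_cmult[of _ UNIV]) (auto intro!: holomorphic_intros)
  finally show ?case using Suc by (auto simp: higher_deriv_power_at_0 less_Suc_eq)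
qed simp

text \<open>\<open>B\<close> bounds the quotient of \<open>g\<close> by the new factor on the disc
  of radius s|lambda_n| about lambda_n: the growth of \<open>f\<close> and the division contribute
  the positive terms 4\<open>\<epsilon>\<close>|lambda_n| + Sg, the lower bound of the divisor the
  rest. The axis constant depends on \<open>N\<close> only through \<open>Sg\<close>, whereas
  \<open>C'\<close> may depend on it freely. In (2/s)^mu_n the powers of 1/s come from Cauchy's
  inequality.\<close>

lemma interpolating_kernel_exists:
  fixes lam :: "nat \<Rightarrow> complex" and mu :: "nat \<Rightarrow> nat"
  assumes inj: "inj lam" and nz: "\<And>m. lam m \<noteq> 0"
    and \<kappa>: "0 < \<kappa>" "\<kappa> \<le> 1" and sector: "\<And>m. \<kappa> * norm (lam m) \<le> Re (lam m)"
    and f: "interp_bounded lam mu \<epsilon> M (\<lambda>m j. if m = n \<and> j = k then 1 else 0) f"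
    and a: "a > 0" and c: "\<And>m. c m > 0"
    and \<delta>: "2 * a + (\<Sum>m<N. 2 * real (mu m) * c m) \<le> \<delta>"
    and ker: "\<And>y. norm (mult_ker a c mu N (\<i> * of_real y)) * (\<Prod>m<N. (1 + (y / norm (lam m))\<^sup>2) ^ mu m) \<le> C0 / (1 + y\<^sup>2)"
    and s: "0 < s" "s \<le> \<kappa> / 2" and n: "n < N"
    and Sg: "Sg = (\<Sum>m<N. real (mu m) * min 1 (4 * norm (lam n) / norm (lam m)))"
    and A: "A = 2 * (1 - ln (\<kappa> / 4))"
    and B: "B = M * exp (4 * \<epsilon> * norm (lam n) + Sg + \<bar>b\<bar> * s * norm (lam n) + 2 * A * \<delta> * norm (lam n) + A * Sg - b * Re (lam n))"
  shows "\<exists>G C'. G holomorphic_on UNIV \<and> C' \<ge> 0 \<and>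
    (\<forall>z. norm (G z) \<le> C' * exp (b * Re z + \<delta> * \<bar>Re z\<bar>) / (1 + (norm z)\<^sup>2)) \<and>
    (\<forall>y. norm (G (\<i> * of_real y)) \<le> real (mu n) * B * (2 / s) ^ mu n * C0 / (1 + y\<^sup>2)) \<and>
    (\<forall>m j. m < N \<longrightarrow> j < mu m \<longrightarrow> (deriv ^^ j) G (lam m) = (if m = n \<and> j = k then fact k else 0))"
proof -
  define r where "r = norm (lam n)"
  have r: "r > 0" using nz by (simp add: r_def)
  have fhol: "f holomorphic_on UNIV" and fbd: "\<And>z. norm (f z) \<le> M * exp (\<epsilon> * norm z)"
    using f by (auto simp: interp_bounded_def)
  have fjet: "(deriv ^^ j) f (lam m) = (if m = n \<and> j = k then fact k else 0)" if "j < mu m" for m j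
  proof -
    have "(deriv ^^ j) f (lam m) / of_nat (fact j) = (if m = n \<and> j = k then 1 else 0)"
      using f that unfolding interp_bounded_def by blast
    then show ?thesis by (auto simp: divide_eq_eq split: if_splits)
  qed
  have M: "M \<ge> 0" using fbd[of 0] norm_ge_zero[of "f 0"] by (simp del: norm_ge_zero)
  have \<delta>0: "\<delta> \<ge> 0"
  proof -
    have "0 \<le> (\<Sum>m<N. 2 * real (mu m) * c m)" using c by (intro sum_nonneg) (simp add: less_imp_le)
    then show ?thesis using \<delta> a by linarith
  qed
  have "ln (\<kappa> / 4) \<le> 0" using \<kappa> by simp
  then have A0: "A \<ge> 0" by (simp add: A)
  \<comment> \<open>The index \<open>n\<close> is left out because \<open>f\<close> has a nonzero
    jet there.\<close>
  define S where "S = {..<N} - {n}"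
  define Q where "Q z = (\<Prod>m\<in>S. (1 - z / lam m) ^ mu m)" for z
  define Pp where "Pp z = (\<Prod>m<N. (1 + z / lam m) ^ mu m)" for z
  define den where "den z = exp (of_real b * z) * mult_ker a c mu N z * Pp z" for z
  have Qhol: "Q holomorphic_on T" for T
    unfolding Q_def[abs_def] using nz by (intro holomorphic_intros) auto
  have denhol: "den holomorphic_on T" for T
    unfolding den_def[abs_def] Pp_def using nz by (intro holomorphic_intros holomorphic_mult_ker) auto
  obtain g where ghol: "g holomorphic_on UNIV" and fg: "\<And>z. f z = Q z * g z"
  proof -
    have "\<exists>g. g holomorphic_on UNIV \<and> (\<forall>z. f z = (\<Prod>m\<in>S. (1 - z / lam m) ^ mu m) * g z)"
      by (rule entire_divide_prod) (use fhol nz fjet inj in \<open>auto simp: S_def inj_on_def\<close>)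
    then show thesis using that unfolding Q_def by blast
  qed
  \<comment> \<open>The small disc about lambda_n lies in the disc of radius 2r, so the reflection
    is done in the circle of radius 4r.\<close>
  have gbd: "norm (g z) \<le> M * exp (4 * \<epsilon> * r) * exp Sg" if z: "norm z \<le> 2 * r" for z
  proof -
    have "norm (g z) \<le> M * exp (4 * \<epsilon> * r) * exp (\<Sum>m\<in>S. real (mu m) * min 1 (4 * r / norm (lam m)))"
    proof (rule entire_quotient_bound[OF _ _ ghol])
      fix w :: complex assume "norm w = 4 * r"
      then show "norm ((\<Prod>m\<in>S. (1 - w / lam m) ^ mu m) * g w) \<le> M * exp (4 * \<epsilon> * r)"
        using fbd[of w] by (simp add: fg Q_def mult_ac)
    qed (use r z nz in \<open>auto simp: S_def\<close>)
    also have "\<dots> \<le> M * exp (4 * \<epsilon> * r) * exp Sg"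
    proof -
      have "0 \<le> real (mu m) * min 1 (4 * r / norm (lam m))" for m using r by simp
      then have "(\<Sum>m\<in>S. real (mu m) * min 1 (4 * r / norm (lam m))) \<le> Sg"
        unfolding Sg r_def[symmetric] by (intro sum_mono2) (auto simp: S_def)
      then show ?thesis using M by (intro mult_left_mono) auto
    qed
    finally show ?thesis .
  qed
  \<comment> \<open>Since s <= \<open>\<kappa>\<close>/2, points of the disc have Re z >=
    \<open>\<kappa>\<close> r/2 and |z| <= 2r. They lie in the sector with constant
    \<open>\<kappa>\<close>/4, which is the origin of the value of \<open>A\<close>.\<close>
  have denbd: "exp (b * Re (lam n) - \<bar>b\<bar> * s * r - 2 * A * \<delta> * r - A * Sg) \<le> norm (den z)"
    if z: "z \<in> cball (lam n) (s * r)" for z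
  proof -
    have zd: "norm (z - lam n) \<le> s * r" using z by (simp add: dist_norm norm_minus_commute)
    have s1: "s \<le> 1" using s \<kappa> by linarith
    have sr: "s * r \<le> 1 * r" using s1 r by (intro mult_right_mono) auto
    have z2: "norm z \<le> 2 * r"
      using norm_triangle_ineq2[of z "lam n"] zd sr by (simp add: r_def)
    have Red: "\<bar>Re z - Re (lam n)\<bar> \<le> s * r" using abs_Re_le_cmod[of "z - lam n"] zd by simp
    have "s * r \<le> \<kappa> / 2 * r" using s r by (intro mult_right_mono) auto
    then have Re1: "Re z \<ge> \<kappa> / 2 * r" using Red sector[of n] unfolding r_def[symmetric] by (simp add: algebra_simps)
    moreover have "\<kappa> / 4 * norm z \<le> \<kappa> / 4 * (2 * r)" using z2 \<kappa> by (intro mult_left_mono) auto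
    ultimately have Rez: "\<kappa> / 4 * norm z \<le> Re z" by simp
    have Re0: "Re z \<ge> 0" using Re1 \<kappa> r by (meson divide_pos_pos less_imp_le mult_pos_pos order_trans zero_less_numeral)
    have 1: "exp (b * Re (lam n) - \<bar>b\<bar> * s * r) \<le> norm (exp (of_real b * z))"
    proof -
      have "\<bar>b * (Re z - Re (lam n))\<bar> \<le> \<bar>b\<bar> * (s * r)"
        unfolding abs_mult using Red by (intro mult_left_mono) auto
      then have "- (\<bar>b\<bar> * (s * r)) \<le> b * (Re z - Re (lam n))" by linarith
      then show ?thesis by (simp add: algebra_simps)
    qed
    have 2: "exp (- (2 * A * \<delta> * r)) \<le> norm (mult_ker a c mu N z)"
    proof -
      have "exp (- (A * \<delta> * norm z)) \<le> norm (mult_ker a c mu N z)"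
        unfolding A using \<kappa> by (intro mult_ker_lower[OF a c \<delta> _ _ Rez]) auto
      moreover have "A * \<delta> * norm z \<le> A * \<delta> * (2 * r)" using z2 A0 \<delta>0 by (intro mult_left_mono) auto
      then have "exp (- (2 * A * \<delta> * r)) \<le> exp (- (A * \<delta> * norm z))" by (simp add: mult_ac)
      ultimately show ?thesis by linarith
    qed
    have 3: "exp (- (A * Sg)) \<le> norm (Pp z)"
    proof -
      have sec4: "\<kappa> / 4 * norm (lam m) \<le> Re (lam m)" for m
      proof -
        have "\<kappa> / 4 * norm (lam m) \<le> \<kappa> * norm (lam m)" using \<kappa> by (intro mult_right_mono) auto
        then show ?thesis using sector[of m] by linarith
      qed
      have "exp (- (A * (\<Sum>m<N. real (mu m) * min 1 (norm z / norm (lam m))))) \<le> norm (Pp z)"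
        unfolding A Pp_def using \<kappa> by (intro prod_one_plus_lower nz sec4 Re0) auto
      moreover have "(\<Sum>m<N. real (mu m) * min 1 (norm z / norm (lam m))) \<le> Sg"
        unfolding Sg
      proof (intro sum_mono mult_left_mono min.mono)
        have "norm z \<le> 4 * norm (lam n)" using z2 r unfolding r_def by linarith
        then show "norm z / norm (lam m) \<le> 4 * norm (lam n) / norm (lam m)" for m
          by (intro divide_right_mono) auto
      qed auto
      then have "A * (\<Sum>m<N. real (mu m) * min 1 (norm z / norm (lam m))) \<le> A * Sg"
        using A0 by (intro mult_left_mono)
      then have "exp (- (A * Sg)) \<le> exp (- (A * (\<Sum>m<N. real (mu m) * min 1 (norm z / norm (lam m)))))" by simp
      ultimately show ?thesis by linarith
    qed
    have "exp (b * Re (lam n) - \<bar>b\<bar> * s * r - 2 * A * \<delta> * r - A * Sg) =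
      exp (b * Re (lam n) - \<bar>b\<bar> * s * r) * exp (- (2 * A * \<delta> * r)) * exp (- (A * Sg))"
      by (simp flip: exp_add)
    also have "\<dots> \<le> norm (den z)"
      unfolding den_def norm_mult by (intro mult_mono 1 2 3) auto
    finally show ?thesis .
  qed
  define \<psi> where "\<psi> z = g z / den z" for z
  have den0: "den z \<noteq> 0" if "z \<in> cball (lam n) (s * r)" for z
    using denbd[OF that] by (metis exp_gt_zero norm_zero not_le)
  have \<psi>bd: "norm (\<psi> z) \<le> B" if z: "z \<in> cball (lam n) (s * r)" for z
  proof -
    have s1: "s \<le> 1" using s \<kappa> by linarith
    have sr: "s * r \<le> 1 * r" using s1 r by (intro mult_right_mono) auto
    have "norm (z - lam n) \<le> s * r" using z by (simp add: dist_norm norm_minus_commute)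
    then have z2: "norm z \<le> 2 * r"
      using norm_triangle_ineq2[of z "lam n"] sr by (simp add: r_def)
    have "norm (\<psi> z) \<le> M * exp (4 * \<epsilon> * r) * exp Sg / exp (b * Re (lam n) - \<bar>b\<bar> * s * r - 2 * A * \<delta> * r - A * Sg)"
      unfolding \<psi>_def norm_divide using gbd[OF z2] denbd[OF z] M by (intro frac_le) auto
    also have "\<dots> = M * (exp (4 * \<epsilon> * r) * exp Sg * exp (- (b * Re (lam n) - \<bar>b\<bar> * s * r - 2 * A * \<delta> * r - A * Sg)))"
      unfolding exp_minus divide_inverse mult.assoc ..
    also have "\<dots> = B" unfolding B r_def exp_add[symmetric] by (simp add: algebra_simps)
    finally show ?thesis .
  qed
  have sr0: "s * r > 0" using s r by simp
  have \<psi>hol: "\<psi> holomorphic_on ball (lam n) (s * r)"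
    unfolding \<psi>_def[abs_def] using den0 denhol ghol holomorphic_on_subset
    by (intro holomorphic_intros) auto
  have \<psi>cont: "continuous_on (cball (lam n) (s * r)) \<psi>"
    unfolding \<psi>_def[abs_def] using den0 denhol ghol holomorphic_on_imp_continuous_on continuous_on_subset
    by (intro continuous_intros) blast+
  define t where "t j = (deriv ^^ j) \<psi> (lam n) / fact j" for j
  have B0: "B \<ge> 0" using M by (simp add: B)
  have tbd: "norm (t j) \<le> B / (s * r) ^ j" for j
  proof -
    have "norm ((deriv ^^ j) \<psi> (lam n)) \<le> fact j * B / (s * r) ^ j"
      by (rule Cauchy_inequality[OF \<psi>hol \<psi>cont sr0]) (auto intro!: \<psi>bd simp: dist_norm)
    then show ?thesis by (simp add: t_def norm_divide divide_le_eq mult_ac)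
  qed
  define \<tau> where "\<tau> z = (\<Sum>j<mu n. t j * (z - lam n) ^ j)" for z
  have \<tau>hol: "\<tau> holomorphic_on T" for T unfolding \<tau>_def[abs_def] by (intro holomorphic_intros)
  define W where "W = real (mu n) * B * (1 / s) ^ mu n"
  have W0: "W \<ge> 0" using B0 s by (simp add: W_def)
  \<comment> \<open>The bound is put in powers of 1 + |z|/r so that it matches the factor of index
    \<open>n\<close> in the products for the kernel.\<close>
  have \<tau>bd: "norm (\<tau> z) \<le> W * (1 + norm z / r) ^ mu n" for z
  proof -
    have x1: "1 \<le> 1 + norm z / r" using r by simp
    have s1: "1 \<le> 1 / s" using s \<kappa> by (simp add: field_simps)
    have "norm (t j * (z - lam n) ^ j) \<le> B * (1 / s) ^ mu n * (1 + norm z / r) ^ mu n" if "j < mu n" for j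
    proof -
      have "norm (z - lam n) \<le> norm z + r" using norm_triangle_ineq4[of z "lam n"] by (simp add: r_def)
      then have "norm (z - lam n) \<le> r * (1 + norm z / r)" using r by (simp add: distrib_left)
      then have "norm ((z - lam n) ^ j) \<le> (r * (1 + norm z / r)) ^ j"
        unfolding norm_power by (intro power_mono) auto
      then have "norm (t j * (z - lam n) ^ j) \<le> B / (s * r) ^ j * (r * (1 + norm z / r)) ^ j"
        unfolding norm_mult using tbd[of j] B0 s r
        by (intro mult_mono) (auto intro!: divide_nonneg_nonneg zero_le_power)
      also have "\<dots> = B * (1 / s) ^ j * (1 + norm z / r) ^ j"
        using s r by (simp add: power_mult_distrib power_divide)
      also have "\<dots> \<le> B * (1 / s) ^ mu n * (1 + norm z / r) ^ mu n"
        using that s1 x1 B0 s(1) by (intro mult_mono power_increasing) (auto intro!: mult_nonneg_nonneg zero_le_power)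
      finally show ?thesis .
    qed
    then have "norm (\<tau> z) \<le> (\<Sum>j<mu n. B * (1 / s) ^ mu n * (1 + norm z / r) ^ mu n)"
      unfolding \<tau>_def by (intro sum_norm_le) auto
    then show ?thesis by (simp add: W_def mult_ac)
  qed
  define G where "G z = den z * Q z * \<tau> z" for z
  have Ghol: "G holomorphic_on UNIV" unfolding G_def[abs_def] by (intro holomorphic_intros denhol Qhol \<tau>hol)
  have N_split: "(\<Prod>m<N. F m) = (\<Prod>m\<in>S. F m) * F n" for F :: "nat \<Rightarrow> real"
    unfolding S_def using n by (subst prod.remove[of _ n]) (auto simp: mult.commute)
  have nPp: "norm (Pp z) = (\<Prod>m\<in>S. norm (1 + z / lam m) ^ mu m) * norm (1 + z / lam n) ^ mu n" for z
    unfolding Pp_def prod_norm[symmetric] norm_power by (rule N_split)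
  \<comment> \<open>Indices in \<open>S\<close> pair up to 1 - (z/lambda_m)^2; index
    \<open>n\<close> keeps only its factor from P, and the other half will come from
    \<open>\<tau>\<close>.\<close>
  have nPQ: "norm (Pp z * Q z) = (\<Prod>m\<in>S. norm (1 - (z / lam m)\<^sup>2) ^ mu m) * norm (1 + z / lam n) ^ mu n" for z
  proof -
    have "norm (1 + w) ^ i * norm (1 - w) ^ i = norm (1 - w\<^sup>2) ^ i" for w :: complex and i
      by (simp add: power_mult_distrib[symmetric] norm_mult[symmetric] power2_eq_square algebra_simps)
    then show ?thesis
      unfolding norm_mult nPp Q_def prod_norm[symmetric] norm_power
      by (simp add: prod.distrib[symmetric] mult_ac)
  qed
  have x1: "norm (1 + z / lam m) \<le> 1 + norm z / norm (lam m)" for z m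
    using norm_triangle_ineq[of 1 "z / lam m"] by (simp add: norm_divide)
  obtain C1 where C1: "C1 \<ge> 0"
    and C1b: "\<And>z. norm (mult_ker a c mu N z) * (\<Prod>m<N. ((1 + norm z / norm (lam m))\<^sup>2) ^ mu m) \<le>
     C1 * exp (\<delta> * \<bar>Re z\<bar>) / (1 + (norm z)\<^sup>2)"
    by (rule mult_ker_growth[where r = "\<lambda>m. norm (lam m)", OF a c _ \<delta>]) (use nz in auto)
  have grow: "norm (G z) \<le> W * C1 * exp (b * Re z + \<delta> * \<bar>Re z\<bar>) / (1 + (norm z)\<^sup>2)" for z
  proof -
    have q: "norm (1 - w\<^sup>2) \<le> (1 + norm w)\<^sup>2" for w :: complex
    proof -
      have "norm (1 - w\<^sup>2) \<le> 1 + (norm w)\<^sup>2" using norm_triangle_ineq4[of 1 "w\<^sup>2"] by (simp add: norm_power)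
      also have "\<dots> \<le> (1 + norm w)\<^sup>2" by (simp add: power2_sum)
      finally show ?thesis .
    qed
    have "norm (1 - (z / lam m)\<^sup>2) \<le> (1 + norm z / norm (lam m))\<^sup>2" for m
      using q[of "z / lam m"] by (simp add: norm_divide)
    then have "norm (Pp z * Q z) \<le> (\<Prod>m\<in>S. ((1 + norm z / norm (lam m))\<^sup>2) ^ mu m) * (1 + norm z / r) ^ mu n"
      unfolding nPQ using x1[of z n]
      by (intro mult_mono prod_mono conjI power_mono) (auto simp: r_def intro!: prod_nonneg)
    then have "norm (Pp z * Q z) * norm (\<tau> z) \<le> ((\<Prod>m\<in>S. ((1 + norm z / norm (lam m))\<^sup>2) ^ mu m) * (1 + norm z / r) ^ mu n) * (W * (1 + norm z / r) ^ mu n)"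
      using \<tau>bd[of z] r by (intro mult_mono) (auto intro!: mult_nonneg_nonneg prod_nonneg)
    also have "\<dots> = W * (\<Prod>m<N. ((1 + norm z / norm (lam m))\<^sup>2) ^ mu m)"
      unfolding N_split by (simp add: r_def power2_eq_square power_mult_distrib)
    finally have P: "norm (Pp z * Q z) * norm (\<tau> z) \<le> W * (\<Prod>m<N. ((1 + norm z / norm (lam m))\<^sup>2) ^ mu m)" .
    have "norm (G z) = exp (b * Re z) * (norm (mult_ker a c mu N z) * (norm (Pp z * Q z) * norm (\<tau> z)))"
      by (simp add: G_def den_def norm_mult)
    also have "\<dots> \<le> exp (b * Re z) * (norm (mult_ker a c mu N z) * (W * (\<Prod>m<N. ((1 + norm z / norm (lam m))\<^sup>2) ^ mu m)))"
      using P by (intro mult_left_mono) auto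
    also have "\<dots> = exp (b * Re z) * W * (norm (mult_ker a c mu N z) * (\<Prod>m<N. ((1 + norm z / norm (lam m))\<^sup>2) ^ mu m))"
      by simp
    also have "\<dots> \<le> exp (b * Re z) * W * (C1 * exp (\<delta> * \<bar>Re z\<bar>) / (1 + (norm z)\<^sup>2))"
      using W0 C1b by (intro mult_left_mono) auto
    also have "\<dots> = W * C1 * exp (b * Re z + \<delta> * \<bar>Re z\<bar>) / (1 + (norm z)\<^sup>2)"
      by (simp add: exp_add)
    finally show ?thesis .
  qed
  have axis: "norm (G (\<i> * of_real y)) \<le> real (mu n) * B * (2 / s) ^ mu n * C0 / (1 + y\<^sup>2)" for y
  proof -
    let ?z = "\<i> * complex_of_real y"
    have nz': "norm ?z = \<bar>y\<bar>" by (simp add: norm_mult)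
    have "norm (1 - (?z / lam m)\<^sup>2) \<le> 1 + (y / norm (lam m))\<^sup>2" for m
      using norm_triangle_ineq4[of 1 "(?z / lam m)\<^sup>2"] by (simp add: norm_power norm_divide norm_mult power_divide)
    then have "norm (Pp ?z * Q ?z) \<le> (\<Prod>m\<in>S. (1 + (y / norm (lam m))\<^sup>2) ^ mu m) * (1 + \<bar>y\<bar> / r) ^ mu n"
      unfolding nPQ using x1[of ?z n] unfolding nz'
      by (intro mult_mono prod_mono conjI power_mono) (auto simp: r_def intro!: prod_nonneg)
    then have "norm (Pp ?z * Q ?z) * norm (\<tau> ?z) \<le> ((\<Prod>m\<in>S. (1 + (y / norm (lam m))\<^sup>2) ^ mu m) * (1 + \<bar>y\<bar> / r) ^ mu n) * (W * (1 + \<bar>y\<bar> / r) ^ mu n)"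
      using \<tau>bd[of ?z] r unfolding nz' by (intro mult_mono) (auto intro!: mult_nonneg_nonneg prod_nonneg)
    also have "\<dots> = W * (\<Prod>m\<in>S. (1 + (y / norm (lam m))\<^sup>2) ^ mu m) * ((1 + \<bar>y\<bar> / r)\<^sup>2) ^ mu n"
      by (simp add: power2_eq_square power_mult_distrib)
    \<comment> \<open>From (1 + x)^2 <= 2(1 + x^2): the unpaired index \<open>n\<close> is brought
      to the quadratic form at the cost of 2^mu_n.\<close>
    also have "\<dots> \<le> W * (\<Prod>m\<in>S. (1 + (y / norm (lam m))\<^sup>2) ^ mu m) * (2 * (1 + (y / norm (lam n))\<^sup>2)) ^ mu n"
    proof (intro mult_left_mono power_mono)
      have "0 \<le> (1 - \<bar>y\<bar> / r)\<^sup>2" by simp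
      then show "(1 + \<bar>y\<bar> / r)\<^sup>2 \<le> 2 * (1 + (y / norm (lam n))\<^sup>2)"
        by (simp add: power2_sum power2_diff power_divide r_def)
      show "0 \<le> W * (\<Prod>m\<in>S. (1 + (y / norm (lam m))\<^sup>2) ^ mu m)"
        using W0 by (intro mult_nonneg_nonneg prod_nonneg) auto
    qed auto
    also have "\<dots> = W * 2 ^ mu n * (\<Prod>m<N. (1 + (y / norm (lam m))\<^sup>2) ^ mu m)"
      unfolding N_split power_mult_distrib by simp
    finally have P: "norm (Pp ?z * Q ?z) * norm (\<tau> ?z) \<le> W * 2 ^ mu n * (\<Prod>m<N. (1 + (y / norm (lam m))\<^sup>2) ^ mu m)" .
    have "norm (G ?z) = norm (mult_ker a c mu N ?z) * (norm (Pp ?z * Q ?z) * norm (\<tau> ?z))"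
      by (simp add: G_def den_def norm_mult)
    also have "\<dots> \<le> norm (mult_ker a c mu N ?z) * (W * 2 ^ mu n * (\<Prod>m<N. (1 + (y / norm (lam m))\<^sup>2) ^ mu m))"
      using P by (intro mult_left_mono) auto
    also have "\<dots> = W * 2 ^ mu n * (norm (mult_ker a c mu N ?z) * (\<Prod>m<N. (1 + (y / norm (lam m))\<^sup>2) ^ mu m))"
      by simp
    also have "\<dots> \<le> W * 2 ^ mu n * (C0 / (1 + y\<^sup>2))" using ker W0 by (intro mult_left_mono) auto
    also have "\<dots> = real (mu n) * B * (2 / s) ^ mu n * C0 / (1 + y\<^sup>2)"
      by (simp add: W_def power_divide)
    finally show ?thesis .
  qed
  have jet: "(deriv ^^ j) G (lam m) = (if m = n \<and> j = k then fact k else 0)" if m: "m < N" and j: "j < mu m" for m j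
  proof (cases "m = n")
    case True
    let ?ball = "ball (lam n) (s * r)"
    have cb: "lam n \<in> ?ball" using sr0 by simp
    have jt: "(deriv ^^ i) (\<lambda>z. \<tau> z - \<psi> z) (lam n) = 0" if "i < mu n" for i
    proof -
      have "(deriv ^^ i) (\<lambda>z. \<tau> z - \<psi> z) (lam n) = (deriv ^^ i) \<tau> (lam n) - (deriv ^^ i) \<psi> (lam n)"
        by (rule higher_deriv_diff[OF \<tau>hol \<psi>hol open_ball cb])
      also have "(deriv ^^ i) \<tau> (lam n) = fact i * t i"
        unfolding \<tau>_def[abs_def] using that by (simp add: higher_deriv_taylor_poly)
      finally show ?thesis by (simp add: t_def)
    qed
    \<comment> \<open>Near lambda_n one has f = den Q \<open>\<psi>\<close>, so G - f = den Q
      (\<open>\<tau>\<close> - \<open>\<psi>\<close>), and the last factor vanishes to order mu_n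
      there.\<close>
    have "(deriv ^^ j) (\<lambda>z. (den z * Q z) * (\<tau> z - \<psi> z)) (lam n) = 0"
      by (rule higher_deriv_mult_eq_0[of _ ?ball])
         (use jt j True cb in \<open>auto intro!: holomorphic_intros denhol Qhol \<tau>hol \<psi>hol\<close>)
    moreover have "(deriv ^^ j) (\<lambda>z. (den z * Q z) * (\<tau> z - \<psi> z)) (lam n) = (deriv ^^ j) (\<lambda>z. G z - f z) (lam n)"
    proof (rule higher_deriv_transform_within_open[OF _ _ open_ball cb])
      show "(\<lambda>z. (den z * Q z) * (\<tau> z - \<psi> z)) holomorphic_on ?ball"
        by (intro holomorphic_intros denhol Qhol \<tau>hol \<psi>hol)
      show "(\<lambda>z. G z - f z) holomorphic_on ?ball"
        using Ghol fhol holomorphic_on_subset by (intro holomorphic_intros) blast+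
      show "(den z * Q z) * (\<tau> z - \<psi> z) = G z - f z" if "z \<in> ?ball" for z
        using den0[of z] that by (simp add: G_def fg \<psi>_def right_diff_distrib)
    qed
    moreover have "(deriv ^^ j) (\<lambda>z. G z - f z) (lam n) = (deriv ^^ j) G (lam n) - (deriv ^^ j) f (lam n)"
      by (rule higher_deriv_diff[OF Ghol fhol]) auto
    ultimately show ?thesis using fjet[OF j] True by simp
  next
    case False
    then have mS: "m \<in> S" using m by (simp add: S_def)
    \<comment> \<open>\<open>G\<close> with the zero of order mu_m that it inherits from
      \<open>Q\<close> split off.\<close>
    define H where "H z = den z * (\<Prod>i\<in>S - {m}. (1 - z / lam i) ^ mu i) * \<tau> z * (- 1 / lam m) ^ mu m" for z
    have Hhol: "H holomorphic_on UNIV"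
      unfolding H_def[abs_def] using nz by (intro holomorphic_intros denhol \<tau>hol) auto
    have "Q z = (1 - z / lam m) ^ mu m * (\<Prod>i\<in>S - {m}. (1 - z / lam i) ^ mu i)" for z
      unfolding Q_def using mS by (intro prod.remove) (auto simp: S_def)
    moreover have "1 - z / lam m = (- 1 / lam m) * (z - lam m)" for z using nz[of m] by (simp add: field_simps)
    then have "(1 - z / lam m) ^ mu m = (- 1 / lam m) ^ mu m * (z - lam m) ^ mu m" for z
      by (metis power_mult_distrib)
    ultimately have "G z = H z * (z - lam m) ^ mu m" for z
      by (simp add: G_def H_def mult_ac)
    then have "G = (\<lambda>z. H z * (z - lam m) ^ mu m)" by blast
    moreover have "(deriv ^^ j) (\<lambda>z. H z * (z - lam m) ^ mu m) (lam m) = 0"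
      by (rule higher_deriv_mult_eq_0[OF Hhol])
         (use j in \<open>auto intro!: holomorphic_intros simp: higher_deriv_power_at_0\<close>)
    ultimately show ?thesis using False by simp
  qed
  have "W * C1 \<ge> 0" using W0 C1 by simp
  then show ?thesis using Ghol grow axis jet by blast
qed

section \<open>Distances\<close>

lemma norm_le_supnorm_on:
  assumes "continuous_on {\<gamma>..\<beta>} f" "x \<in> {\<gamma>..\<beta>}"
  shows "norm (f x) \<le> supnorm_on \<gamma> \<beta> f"
proof -
  have "compact ((\<lambda>x. norm (f x)) ` {\<gamma>..\<beta>})"
    using assms(1) by (intro compact_continuous_image continuous_intros) auto
  then have "bdd_above ((\<lambda>x. norm (f x)) ` {\<gamma>..\<beta>})"
    by (intro bounded_imp_bdd_above compact_imp_bounded)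
  then show ?thesis unfolding supnorm_on_def using assms(2) by (intro cSUP_upper)
qed

lemma supnorm_on_triangle:
  assumes "continuous_on {\<gamma>..\<beta>} f" "continuous_on {\<gamma>..\<beta>} g" "continuous_on {\<gamma>..\<beta>} h" "\<gamma> \<le> \<beta>"
  shows "supnorm_on \<gamma> \<beta> (\<lambda>x. f x - h x) \<le> supnorm_on \<gamma> \<beta> (\<lambda>x. f x - g x) + supnorm_on \<gamma> \<beta> (\<lambda>x. g x - h x)"
  unfolding supnorm_on_def[of \<gamma> \<beta> "\<lambda>x. f x - h x"]
proof (rule cSUP_least)
  fix x assume x: "x \<in> {\<gamma>..\<beta>}"
  have "norm (f x - h x) \<le> norm (f x - g x) + norm (g x - h x)"
    using norm_triangle_ineq[of "f x - g x" "g x - h x"] by simp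
  also have "\<dots> \<le> supnorm_on \<gamma> \<beta> (\<lambda>x. f x - g x) + supnorm_on \<gamma> \<beta> (\<lambda>x. g x - h x)"
    using assms x by (intro add_mono norm_le_supnorm_on continuous_intros)
  finally show "norm (f x - h x) \<le> supnorm_on \<gamma> \<beta> (\<lambda>x. f x - g x) + supnorm_on \<gamma> \<beta> (\<lambda>x. g x - h x)" .
qed (use assms in auto)

lemma continuous_on_span_E_minus:
  "p \<in> span_E_minus lam mu n k \<Longrightarrow> continuous_on S p"
  unfolding span_E_minus_def emon_def by (auto simp: split_def intro!: continuous_intros)

text \<open>Elements of the closed span are within any \<open>d\<close> of the span, so the triangle
  inequality reduces the infimum to finite sums.\<close>

lemma D_dist_geI:
  assumes gb: "\<gamma> \<le> \<beta>"
    and le: "\<And>p. p \<in> span_E_minus lam mu n k \<Longrightarrow> L \<le> supnorm_on \<gamma> \<beta> (\<lambda>x. emon lam n k x - p x)"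
  shows "L \<le> D_dist \<gamma> \<beta> lam mu n k"
  unfolding D_dist_def
proof (rule cINF_greatest)
  have "(\<lambda>x. 0) \<in> span_E_minus lam mu n k"
    unfolding span_E_minus_def by (auto intro!: exI[of _ "{}"])
  then have "(\<lambda>x. 0) \<in> closed_span_E_minus \<gamma> \<beta> lam mu n k"
    unfolding closed_span_E_minus_def using gb by (auto simp: supnorm_on_def intro!: bexI[of _ "\<lambda>x. 0"])
  then show "closed_span_E_minus \<gamma> \<beta> lam mu n k \<noteq> {}" by blast
  fix g assume g: "g \<in> closed_span_E_minus \<gamma> \<beta> lam mu n k"
  show "L \<le> supnorm_on \<gamma> \<beta> (\<lambda>x. emon lam n k x - g x)"
  proof (rule field_le_epsilon)
    fix d :: real assume "d > 0"
    then obtain p where p: "p \<in> span_E_minus lam mu n k" and pd: "supnorm_on \<gamma> \<beta> (\<lambda>x. g x - p x) < d"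
      using g unfolding closed_span_E_minus_def by blast
    have "supnorm_on \<gamma> \<beta> (\<lambda>x. emon lam n k x - p x) \<le>
       supnorm_on \<gamma> \<beta> (\<lambda>x. emon lam n k x - g x) + supnorm_on \<gamma> \<beta> (\<lambda>x. g x - p x)"
    proof (rule supnorm_on_triangle[OF _ _ _ gb])
      show "continuous_on {\<gamma>..\<beta>} (emon lam n k)" unfolding emon_def[abs_def] by (intro continuous_intros)
      show "continuous_on {\<gamma>..\<beta>} g" using g by (simp add: closed_span_E_minus_def)
      show "continuous_on {\<gamma>..\<beta>} p" using p by (rule continuous_on_span_E_minus)
    qed
    then show "L \<le> supnorm_on \<gamma> \<beta> (\<lambda>x. emon lam n k x - g x) + d" using le[OF p] pd by linarith
  qed
qed

text \<open>The functional represented by \<open>G\<close> annihilates every term of the sum and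
  takes the value k! >= 1 at e_{n,k}; comparison with its norm bounds the distance from
  below.\<close>

lemma biorthogonal_lower_bound:
  fixes G :: "complex \<Rightarrow> complex"
  assumes hol: "G holomorphic_on UNIV" and gb: "\<gamma> \<le> \<beta>"
    and right: "\<And>z. Re z \<ge> 0 \<Longrightarrow> norm (G z) \<le> C' * exp (\<beta> * Re z) / (1 + (norm z)\<^sup>2)"
    and left: "\<And>z. Re z \<le> 0 \<Longrightarrow> norm (G z) \<le> C' * exp (\<gamma> * Re z) / (1 + (norm z)\<^sup>2)"
    and axis: "\<And>y::real. norm (G (\<i> * of_real y)) \<le> C / (1 + y\<^sup>2)"
    and lam: "\<And>m. Re (lam m) > 0"
    and T: "finite T" "(n, k) \<notin> T"
    and jet: "\<And>m j. (m, j) \<in> insert (n, k) T \<Longrightarrow> (deriv ^^ j) G (lam m) = (if m = n \<and> j = k then fact k else 0)"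
  shows "1 \<le> C / 2 * supnorm_on \<gamma> \<beta> (\<lambda>x. emon lam n k x - (\<Sum>(m, j)\<in>T. d (m, j) * emon lam m j x)) * (\<beta> - \<gamma>)"
proof -
  define c where "c i = (if i = (n, k) then 1 else - d i)" for i
  have nT: "(n, k) \<notin> T" by (rule T)
  let ?g = "\<lambda>x. emon lam n k x - (\<Sum>(m, j)\<in>T. d (m, j) * emon lam m j x)"
  have g: "?g x = (\<Sum>i\<in>insert (n, k) T. c i * (of_real x ^ snd i * exp (lam (fst i) * of_real x)))" for x
  proof -
    have "(\<Sum>i\<in>T. c i * (of_real x ^ snd i * exp (lam (fst i) * of_real x))) = (\<Sum>i\<in>T. - (d i * emon lam (fst i) (snd i) x))"
      using nT by (intro sum.cong) (auto simp: c_def emon_def)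
    then show ?thesis using nT T by (simp add: c_def emon_def sum_negf split_def)
  qed
  have cont: "continuous_on {\<gamma>..\<beta>} ?g"
    unfolding emon_def split_def by (intro continuous_intros)
  have "norm (\<Sum>i\<in>insert (n, k) T. c i * (deriv ^^ snd i) G (lam (fst i))) \<le> C / 2 * supnorm_on \<gamma> \<beta> ?g * (\<beta> - \<gamma>)"
  proof (rule laplace_functional_bound[OF hol gb right left axis])
    show "norm (\<Sum>i\<in>insert (n, k) T. c i * (of_real x ^ snd i * exp (lam (fst i) * of_real x))) \<le> supnorm_on \<gamma> \<beta> ?g"
      if "x \<in> {\<gamma>..\<beta>}" for x
      using norm_le_supnorm_on[OF cont that] unfolding g .
  qed (use lam T in auto)
  also have "(\<Sum>i\<in>insert (n, k) T. c i * (deriv ^^ snd i) G (lam (fst i))) = (\<Sum>i\<in>insert (n, k) T. if i = (n, k) then fact k else 0)"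
    using jet by (intro sum.cong) (auto simp: c_def split: if_splits)
  also have "\<dots> = fact k" using T by (simp add: sum.delta)
  finally have "fact k \<le> C / 2 * supnorm_on \<gamma> \<beta> ?g * (\<beta> - \<gamma>)" by simp
  moreover have "(1::real) \<le> fact k" by (rule fact_ge_1)
  ultimately show ?thesis by linarith
qed

section \<open>Choice of the constants and the lower bound for the distances\<close>

theorem theorem10p1:
  fixes lam :: "nat \<Rightarrow> complex" and mu :: "nat \<Rightarrow> nat" and \<gamma> \<beta> :: real
  assumes "class_ABC lam mu"
    and "\<gamma> < \<beta>"
  shows "\<forall>\<epsilon>>0. \<exists>u>0. \<forall>n. \<forall>k<mu n.
           D_dist \<gamma> \<beta> lam mu n k \<ge> u * exp ((\<beta> - \<epsilon>) * Re (lam n))"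
proof (intro allI impI)
  fix \<epsilon> :: real assume \<epsilon>: "\<epsilon> > 0"
  have inj: "inj lam" and nz: "\<And>m. lam m \<noteq> 0" and sm: "summable (\<lambda>n. real (mu n) / norm (lam n))"
    and int: "interpolating_variety_A0 lam mu"
    using assms(1) by (auto simp: class_ABC_def multiplicity_seq_def)
  obtain \<theta> where \<theta>: "\<theta> < pi / 2" "\<And>n. \<bar>Arg (lam n)\<bar> \<le> \<theta>"
    using assms(1) by (auto simp: class_ABC_def)
  define \<kappa> where "\<kappa> = cos \<theta>"
  have \<theta>0: "\<theta> \<ge> 0" using \<theta>(2)[of 0] by linarith
  have \<kappa>: "0 < \<kappa>" "\<kappa> \<le> 1" unfolding \<kappa>_def using \<theta>(1) \<theta>0 by (auto intro: cos_gt_zero_pi)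
  have sector: "\<kappa> * norm (lam m) \<le> Re (lam m)" for m
  proof -
    have "cos \<theta> \<le> cos \<bar>Arg (lam m)\<bar>"
      using \<theta>(2)[of m] \<theta>(1) pi_gt_zero by (intro cos_monotone_0_pi_le) auto
    then have "\<kappa> * norm (lam m) \<le> cos (Arg (lam m)) * norm (lam m)"
      unfolding \<kappa>_def by (intro mult_right_mono) auto
    also have "\<dots> = Re (lam m)" using nz[of m] by (simp add: cos_Arg)
    finally show ?thesis .
  qed
  have pos: "norm (lam m) > 0" for m using nz by simp
  have Repos: "Re (lam m) > 0" for m using sector[of m] \<kappa> pos[of m] by (meson less_le_trans mult_pos_pos)
  define A where "A = 2 * (1 - ln (\<kappa> / 4))"
  have "ln (\<kappa> / 4) \<le> 0" using \<kappa> by simp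
  then have A0: "A \<ge> 0" by (simp add: A_def)
  \<comment> \<open>There are five losses of exp(\<open>\<omega>\<close> |lambda_n|): the growth of
    \<open>f\<close>, the terms with \<open>Sg\<close>, the size of \<open>s\<close>, the type
    \<open>\<delta>\<close>, and the factor mu_n (2/s)^mu_n. Since Re lambda_n >=
    \<open>\<kappa>\<close> |lambda_n|, together they cost \<open>\<epsilon>\<close>/2 times Re
    lambda_n.\<close>
  define \<omega> where "\<omega> = \<kappa> * \<epsilon> / 10"
  have \<omega>: "\<omega> > 0" using \<kappa> \<epsilon> by (simp add: \<omega>_def)
  \<comment> \<open>The first entry limits the loss from the kernel's lower bound; the second lets
    the shift from \<open>\<beta>\<close> to \<open>b\<close> use the other half of
    \<open>\<epsilon>\<close>; the third gives b - \<open>\<delta>\<close> >=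
    \<open>\<gamma>\<close>, so that the exponents of \<open>G\<close> stay within
    [\<open>\<gamma>\<close>, \<open>\<beta>\<close>].\<close>
  define \<delta> where "\<delta> = min (\<omega> / (2 * A + 1)) (min (\<epsilon> / 2) ((\<beta> - \<gamma>) / 2))"
  have "\<delta> > 0" using \<omega> A0 \<epsilon> assms(2) by (simp add: \<delta>_def)
  moreover have "\<delta> \<le> \<epsilon> / 2" unfolding \<delta>_def by (intro min.coboundedI2 min.cobounded1)
  moreover have "\<delta> \<le> (\<beta> - \<gamma>) / 2" unfolding \<delta>_def by (intro min.coboundedI2 min.cobounded2)
  ultimately have \<delta>: "\<delta> > 0" "\<delta> \<le> \<epsilon> / 2" "\<delta> \<le> (\<beta> - \<gamma>) / 2" .
  have A\<delta>: "2 * A * \<delta> \<le> \<omega>"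
  proof -
    have "(2 * A + 1) * \<delta> \<le> (2 * A + 1) * (\<omega> / (2 * A + 1))"
      using A0 by (intro mult_left_mono) (auto simp: \<delta>_def)
    also have "\<dots> = \<omega>" using A0 by simp
    finally show ?thesis using \<delta>(1) by (simp add: distrib_right)
  qed
  define b where "b = \<beta> - \<delta>"
  define s where "s = min (\<kappa> / 2) (\<omega> / (\<bar>b\<bar> + 1))"
  have "0 < s" using \<kappa> \<omega> by (simp add: s_def)
  moreover have "s \<le> \<kappa> / 2" unfolding s_def by (rule min.cobounded1)
  ultimately have s: "0 < s" "s \<le> \<kappa> / 2" .
  have bs: "\<bar>b\<bar> * s \<le> \<omega>"
  proof -
    have "(\<bar>b\<bar> + 1) * s \<le> (\<bar>b\<bar> + 1) * (\<omega> / (\<bar>b\<bar> + 1))"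
      by (intro mult_left_mono) (auto simp: s_def)
    also have "\<dots> = \<omega>" by simp
    finally show ?thesis using s(1) by (simp add: distrib_right)
  qed
  \<comment> \<open>Chosen so that mu (2/s)^mu <= exp(l mu), using mu <= exp mu.\<close>
  define l where "l = 1 + ln (2 / s)"
  have "2 / s \<ge> 1" using s \<kappa> by (simp add: field_simps)
  then have l: "l \<ge> 1" by (simp add: l_def)
  \<comment> \<open>\<open>Sg\<close> is taken at radius 4|lambda_n| and enters the exponent with
    coefficient 1 + A; this tolerance leaves exactly \<open>\<omega>\<close> |lambda_n|.\<close>
  have \<omega>A: "\<omega> / (4 * (1 + A)) > 0" using \<omega> A0 by simp
  obtain C1 where C1: "\<And>N R. R \<ge> 0 \<Longrightarrow> (\<Sum>m<N. real (mu m) * min 1 (R / norm (lam m))) \<le> C1 + \<omega> / (4 * (1 + A)) * R"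
    using sum_min_le[OF sm pos \<omega>A] by auto
  have mu_le: "\<exists>C. \<forall>n. real (mu n) \<le> C + \<eta> * norm (lam n)" if \<eta>: "\<eta> > 0" for \<eta>
  proof -
    obtain C where C: "\<And>N R. R \<ge> 0 \<Longrightarrow> (\<Sum>m<N. real (mu m) * min 1 (R / norm (lam m))) \<le> C + \<eta> * R"
      using sum_min_le[OF sm pos \<eta>] by auto
    have "real (mu n) \<le> C + \<eta> * norm (lam n)" for n
    proof -
      \<comment> \<open>With R = |lambda_n| the term of index \<open>n\<close> in the sum is mu_n
        itself.\<close>
      have "real (mu n) = real (mu n) * min 1 (norm (lam n) / norm (lam n))" using pos[of n] by simp
      also have "\<dots> \<le> (\<Sum>m<Suc n. real (mu m) * min 1 (norm (lam n) / norm (lam m)))"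
        by (rule member_le_sum) (auto intro!: mult_nonneg_nonneg)
      also have "\<dots> \<le> C + \<eta> * norm (lam n)" by (rule C) simp
      finally show ?thesis .
    qed
    then show ?thesis by blast
  qed
  obtain C2 where C2: "\<And>n. real (mu n) \<le> C2 + \<omega> / l * norm (lam n)"
    using mu_le[of "\<omega> / l"] \<omega> l by auto
  have mu_exp: "\<exists>C. \<forall>n. real (mu n) \<le> C * exp (\<eta> * norm (lam n))" if \<eta>: "\<eta> > 0" for \<eta>
  proof -
    obtain C where C: "\<And>n. real (mu n) \<le> C + \<eta> * norm (lam n)" using mu_le[OF \<eta>] by blast
    have "real (mu n) \<le> (\<bar>C\<bar> + 1) * exp (\<eta> * norm (lam n))" for n
    proof -
      have "\<eta> * norm (lam n) \<le> exp (\<eta> * norm (lam n))" using exp_ge_add_one_self[of "\<eta> * norm (lam n)"] by linarith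
      moreover have "C \<le> \<bar>C\<bar> * exp (\<eta> * norm (lam n))"
        using mult_left_mono[of 1 "exp (\<eta> * norm (lam n))" "\<bar>C\<bar>"] \<eta> by simp
      ultimately show ?thesis using C[of n] by (simp add: distrib_right)
    qed
    then show ?thesis by blast
  qed
  \<comment> \<open>A quarter, because \<open>f\<close> is estimated on the circle of radius
    4|lambda_n|.\<close>
  have \<omega>4: "\<omega> / 4 > 0" using \<omega> by simp
  obtain M where M: "\<And>n k. k < mu n \<Longrightarrow>
    \<exists>f. interp_bounded lam mu (\<omega> / 4) M (\<lambda>m j. if m = n \<and> j = k then 1 else 0) f"
    using uniform_interpolation[OF int mu_exp \<omega>4] by auto
  obtain a c C0 where a: "a > 0" and c: "\<And>m. c m > 0" and C0: "C0 \<ge> 0"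
    and type: "\<And>N. 2 * a + (\<Sum>m<N. 2 * real (mu m) * c m) \<le> \<delta>"
    and ker: "\<And>N y. norm (mult_ker a c mu N (\<i> * of_real y)) * (\<Prod>m<N. (1 + (y / norm (lam m))\<^sup>2) ^ mu m) \<le> C0 / (1 + y\<^sup>2)"
    using multiplier_exists[OF sm pos \<delta>(1)] by auto
  define E where "E = (1 + A) * C1 + l * C2"
  \<comment> \<open>The sign of \<open>M\<close> is known only once an interpolating function is at
    hand, hence the absolute value; adding 1 keeps \<open>K\<close> positive.\<close>
  define K where "K = \<bar>M\<bar> * C0 * exp E + 1"
  have K: "K > 0" unfolding K_def using C0 by (intro add_nonneg_pos mult_nonneg_nonneg) auto
  have main: "1 \<le> K * exp (- ((\<beta> - \<epsilon>) * Re (lam n))) / 2 * supnorm_on \<gamma> \<beta> (\<lambda>x. emon lam n k x - p x) * (\<beta> - \<gamma>)"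
    if k: "k < mu n" and p: "p \<in> span_E_minus lam mu n k" for n k p
  proof -
    obtain T d where T: "finite T" "T \<subseteq> {(m, j). j < mu m} - {(n, k)}"
      and pd: "p = (\<lambda>x. \<Sum>(m, j)\<in>T. d (m, j) * emon lam m j x)"
      using p unfolding span_E_minus_def by blast
    \<comment> \<open>Covers \<open>n\<close> and all indices in the given finite sum;
      \<open>K\<close> was fixed before, so the bound does not see \<open>N\<close>.\<close>
    define N where "N = Suc (Max (insert n (fst ` T)))"
    have N: "m < N" if "(m, j) \<in> insert (n, k) T" for m j
    proof -
      have "m \<in> insert n (fst ` T)" using that by force
      then have "m \<le> Max (insert n (fst ` T))" using T by (intro Max_ge) auto
      then show ?thesis by (simp add: N_def)
    qed
    have nN: "n < N" by (rule N[of n k]) simp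
    obtain f where f: "interp_bounded lam mu (\<omega> / 4) M (\<lambda>m j. if m = n \<and> j = k then 1 else 0) f"
      using M[OF k] by blast
    have M0: "M \<ge> 0"
    proof -
      have "norm (f 0) \<le> M * exp (\<omega> / 4 * norm (0::complex))" using f unfolding interp_bounded_def by blast
      then show ?thesis using norm_ge_zero[of "f 0"] by (simp del: norm_ge_zero)
    qed
    define r where "r = norm (lam n)"
    define Sg where "Sg = (\<Sum>m<N. real (mu m) * min 1 (4 * norm (lam n) / norm (lam m)))"
    define B where "B = M * exp (4 * (\<omega> / 4) * norm (lam n) + Sg + \<bar>b\<bar> * s * norm (lam n) + 2 * A * \<delta> * norm (lam n) + A * Sg - b * Re (lam n))"
    obtain G C' where Ghol: "G holomorphic_on UNIV" and C': "C' \<ge> 0"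
      and grow: "\<And>z. norm (G z) \<le> C' * exp (b * Re z + \<delta> * \<bar>Re z\<bar>) / (1 + (norm z)\<^sup>2)"
      and axis: "\<And>y. norm (G (\<i> * of_real y)) \<le> real (mu n) * B * (2 / s) ^ mu n * C0 / (1 + y\<^sup>2)"
      and jet: "\<And>m j. m < N \<Longrightarrow> j < mu m \<Longrightarrow> (deriv ^^ j) G (lam m) = (if m = n \<and> j = k then fact k else 0)"
      using interpolating_kernel_exists[OF inj nz \<kappa> sector f a c type ker s nN Sg_def A_def B_def] by blast
    have Sg: "(1 + A) * Sg \<le> (1 + A) * C1 + \<omega> * r"
    proof -
      have "Sg \<le> C1 + \<omega> / (4 * (1 + A)) * (4 * r)" unfolding Sg_def r_def by (rule C1) simp
      then have "(1 + A) * Sg \<le> (1 + A) * (C1 + \<omega> / (4 * (1 + A)) * (4 * r))" using A0 by (intro mult_left_mono) auto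
      also have "\<dots> = (1 + A) * C1 + \<omega> * r"
      proof -
        have "q * (C1 + \<omega> / (4 * q) * (4 * r)) = q * C1 + \<omega> * r" if "q \<noteq> 0" for q
          using that by (simp add: distrib_left)
        moreover have "1 + A \<noteq> 0" using A0 by linarith
        ultimately show ?thesis .
      qed
      finally show ?thesis .
    qed
    have mus: "real (mu n) * (2 / s) ^ mu n \<le> exp (l * C2 + \<omega> * r)"
    proof -
      have "real (mu n) \<le> exp (real (mu n))" using exp_ge_add_one_self[of "real (mu n)"] by linarith
      moreover have "(2 / s) ^ mu n = exp (real (mu n) * ln (2 / s))"
        using s by (simp add: exp_of_nat_mult)
      ultimately have "real (mu n) * (2 / s) ^ mu n \<le> exp (real (mu n)) * exp (real (mu n) * ln (2 / s))"
        by (intro mult_mono) auto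
      also have "\<dots> = exp (l * real (mu n))" by (simp add: l_def algebra_simps flip: exp_add)
      also have "\<dots> \<le> exp (l * (C2 + \<omega> / l * r))"
        using C2[of n] l by (simp add: r_def)
      also have "l * (C2 + \<omega> / l * r) = l * C2 + \<omega> * r" using l by (simp add: distrib_left)
      finally show ?thesis .
    qed
    have Cle: "real (mu n) * B * (2 / s) ^ mu n * C0 \<le> K * exp (- ((\<beta> - \<epsilon>) * Re (lam n)))"
    proof -
      define x where "x = 4 * (\<omega> / 4) * norm (lam n) + Sg + \<bar>b\<bar> * s * norm (lam n) + 2 * A * \<delta> * norm (lam n) + A * Sg - b * Re (lam n)"
      have "real (mu n) * B * (2 / s) ^ mu n * C0 = M * C0 * (real (mu n) * (2 / s) ^ mu n * exp x)"
        by (simp add: B_def x_def mult_ac)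
      also have "\<dots> \<le> M * C0 * (exp (l * C2 + \<omega> * r) * exp x)"
        using M0 C0 mus by (intro mult_left_mono mult_right_mono) auto
      also have "\<dots> = M * C0 * exp (l * C2 + \<omega> * r + x)" by (simp add: exp_add)
      also have "\<dots> \<le> M * C0 * exp (E + - ((\<beta> - \<epsilon>) * Re (lam n)))"
      proof -
        have r0: "r > 0" using pos[of n] by (simp add: r_def)
        have 1: "\<bar>b\<bar> * s * r \<le> \<omega> * r" using bs r0 by (intro mult_right_mono) auto
        have 2: "2 * A * \<delta> * r \<le> \<omega> * r" using A\<delta> r0 by (intro mult_right_mono) auto
        have 3: "\<delta> * Re (lam n) \<le> \<epsilon> / 2 * Re (lam n)" using \<delta>(2) Repos[of n] by (intro mult_right_mono) auto
        have "\<epsilon> / 2 * (\<kappa> * r) \<le> \<epsilon> / 2 * Re (lam n)" using sector[of n] \<epsilon> by (intro mult_left_mono) (auto simp: r_def)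
        then have 4: "5 * (\<omega> * r) \<le> \<epsilon> / 2 * Re (lam n)" by (simp add: \<omega>_def mult_ac)
        have Sg': "Sg + A * Sg \<le> (1 + A) * C1 + \<omega> * r" using Sg by (simp add: distrib_right)
        have "b * Re (lam n) = \<beta> * Re (lam n) - \<delta> * Re (lam n)" by (simp add: b_def left_diff_distrib)
        moreover have "(\<beta> - \<epsilon>) * Re (lam n) = \<beta> * Re (lam n) - 2 * (\<epsilon> / 2 * Re (lam n))" by (simp add: left_diff_distrib)
        moreover have "4 * (\<omega> / 4) * norm (lam n) = \<omega> * r" by (simp add: r_def)
        ultimately have "l * C2 + \<omega> * r + x \<le> E + - ((\<beta> - \<epsilon>) * Re (lam n))"
          using 1 2 3 4 Sg' unfolding x_def E_def r_def[symmetric] by linarith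
        then show ?thesis using M0 C0 by (intro mult_left_mono) auto
      qed
      also have "\<dots> = M * C0 * exp E * exp (- ((\<beta> - \<epsilon>) * Re (lam n)))" by (simp only: exp_add mult.assoc)
      also have "\<dots> \<le> K * exp (- ((\<beta> - \<epsilon>) * Re (lam n)))"
        unfolding K_def using M0 by (intro mult_right_mono) auto
      finally show ?thesis .
    qed
    have "1 \<le> (K * exp (- ((\<beta> - \<epsilon>) * Re (lam n)))) / 2 * supnorm_on \<gamma> \<beta> (\<lambda>x. emon lam n k x - (\<Sum>(m, j)\<in>T. d (m, j) * emon lam m j x)) * (\<beta> - \<gamma>)"
    proof (rule biorthogonal_lower_bound[OF Ghol _ _ _ _ Repos T(1)])
      show "(n, k) \<notin> T" using T(2) by blast
      show "\<gamma> \<le> \<beta>" using assms(2) by simp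
      show "norm (G z) \<le> C' * exp (\<beta> * Re z) / (1 + (norm z)\<^sup>2)" if "Re z \<ge> 0" for z
        using grow[of z] that by (simp add: b_def algebra_simps)
      show "norm (G z) \<le> C' * exp (\<gamma> * Re z) / (1 + (norm z)\<^sup>2)" if "Re z \<le> 0" for z
      proof -
        have "(b - \<delta>) * Re z \<le> \<gamma> * Re z"
          using that \<delta>(3) by (intro mult_right_mono_neg) (auto simp: b_def)
        then have "b * Re z + \<delta> * \<bar>Re z\<bar> \<le> \<gamma> * Re z" using that by (simp add: left_diff_distrib)
        then have "C' * exp (b * Re z + \<delta> * \<bar>Re z\<bar>) / (1 + (norm z)\<^sup>2) \<le> C' * exp (\<gamma> * Re z) / (1 + (norm z)\<^sup>2)"
          using C' by (intro divide_right_mono mult_left_mono) (auto intro!: add_nonneg_nonneg)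
        then show ?thesis using grow[of z] by linarith
      qed
      show "norm (G (\<i> * of_real y)) \<le> K * exp (- ((\<beta> - \<epsilon>) * Re (lam n))) / (1 + y\<^sup>2)" for y
        by (rule order_trans[OF axis divide_right_mono[OF Cle]]) (auto intro!: add_nonneg_nonneg)
      show "(deriv ^^ j) G (lam m) = (if m = n \<and> j = k then fact k else 0)" if "(m, j) \<in> insert (n, k) T" for m j
        using jet[OF N[OF that]] that T k by auto
    qed
    then show ?thesis by (simp only: pd)
  qed
  show "\<exists>u>0. \<forall>n. \<forall>k<mu n. D_dist \<gamma> \<beta> lam mu n k \<ge> u * exp ((\<beta> - \<epsilon>) * Re (lam n))"
  proof (intro exI[of _ "2 / (K * (\<beta> - \<gamma>))"] conjI allI impI)
    show "2 / (K * (\<beta> - \<gamma>)) > 0" using K assms(2) by simp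
    fix n k assume k: "k < mu n"
    show "2 / (K * (\<beta> - \<gamma>)) * exp ((\<beta> - \<epsilon>) * Re (lam n)) \<le> D_dist \<gamma> \<beta> lam mu n k"
    proof (rule D_dist_geI)
      show "\<gamma> \<le> \<beta>" using assms(2) by simp
      fix p assume "p \<in> span_E_minus lam mu n k"
      have alg: "2 / (K * w) * e \<le> S" if "1 \<le> K * inverse e / 2 * S * w" "w > 0" "e > 0" for e w S :: real
        using that K by (simp add: field_simps)
      show "2 / (K * (\<beta> - \<gamma>)) * exp ((\<beta> - \<epsilon>) * Re (lam n)) \<le> supnorm_on \<gamma> \<beta> (\<lambda>x. emon lam n k x - p x)"
        by (rule alg) (use main[OF k \<open>p \<in> _\<close>] assms(2) in \<open>auto simp: exp_minus\<close>)
    qed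
  qed
qed

end
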